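(* Let $p$ be an odd prime and let $G,H$ be two groups of order $p^6$ belonging to the set $\{\Phi_5(3111),\ \Phi_5(2211)a,\ \Phi_5(2211)b,\ \Phi_5(21^4)c\}$. Then $G\sim_{\mathbb C}H$.
   Context: The groups (of order $p^6$, $p$ odd, in R. James's notation) are generated by $\alpha_1,\alpha_2,\alpha_3,\alpha_4,\beta$ with $[x,y]=x^{-1}y^{-1}xy$, with the relations $[\alpha_1,\alpha_2]=[\alpha_3,\alpha_4]=\beta$, $\beta^p=1$, all other commutators of pairs of generators trivial, and in addition: - $\Phi_5(3111)$: $\alpha_1^{p^2}=\beta$, $\alpha_2^p=\alpha_3^p=\alpha_4^p=1$; - $\Phi_5(2211)a$: $\alpha_2^p=\beta$, $\alpha_1^{p^2}=\alpha_3^p=\alpha_4^p=1$; - $\Phi_5(2211)b$: $\alpha_3^p=\beta$, $\alpha_1^{p^2}=\alpha_2^p=\alpha_4^p=1$; - $\Phi_5(21^4)c$: $\alpha_1^{p^2}=\alpha_2^p=\alpha_3^p=\alpha_4^p=1$. For a finite group $G$, $H^2(G,\mathbb C^\times)$ is the second cohomology group with trivial action. For a $2$-cocycle $\alpha\in Z^2(G,\mathbb C^\times)$, the twisted group algebra $\mathbb C^\alpha G$ is the $\mathbb C$-vector space with basis $\{\bar g: g\in G\}$ and multiplication determined by $\bar g\,\bar h=\alpha(g,h)\overline{gh}$; up to isomorphism it depends only on the class $[\alpha]$. For finite groups $G,H$ we write $G\sim_{\mathbb C}H$ if there is a group isomorphism $\psi:H^2(G,\mathbb C^\times)\to H^2(H,\mathbb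 C^\times)$ such that $\mathbb C^\alpha G\cong\mathbb C^{\psi(\alpha)}H$ (as $\mathbb C$-algebras) for every $[\alpha]\in H^2(G,\mathbb C^\times)$, where $\psi(\alpha)$ denotes a cocycle representing $\psi([\alpha])$. *)

theory Defs
  imports Complex_Main "HOL-Computational_Algebra.Primes"
    "HOL-Algebra.Coset" "HOL-Algebra.QuotRing" "HOL-Algebra.Module"
begin

section \<open>Groups given by generators and relations\<close>

text \<open>
  A word is a list of letters; the letter \<open>(x, True)\<close> stands for the generator \<open>x\<close> and
  \<open>(x, False)\<close> for its inverse. The generating set is the whole type \<open>'x\<close>, and a pair
  \<open>(r, s)\<close> of words encodes the relation \<open>r = s\<close>.
\<close>

type_synonym 'x word = "('x \<times> bool) list"

inductive word_step :: "('x word \<times> 'x word) set \<Rightarrow> 'x word \<Rightarrow> 'x word \<Rightarrow> bool"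
  for R where
  cancel: "word_step R (u @ [(x, b), (x, \<not> b)] @ v) (u @ v)"
| relation: "(r, s) \<in> R \<Longrightarrow> word_step R (u @ r @ v) (u @ s @ v)"

definition word_rel :: "('x word \<times> 'x word) set \<Rightarrow> ('x word \<times> 'x word) set" where
  "word_rel R = {(u, v). equivclp (word_step R) u v}"

definition presented_group :: "('x word \<times> 'x word) set \<Rightarrow> 'x word set monoid" where
  "presented_group R =
    \<lparr>carrier = UNIV // word_rel R,
     mult = (\<lambda>U V. \<Union>u\<in>U. \<Union>v\<in>V. word_rel R `` {u @ v}),
     one = word_rel R `` {[]}\<rparr>"

definition gen :: "'x \<Rightarrow> 'x word" where
  "gen x = [(x, True)]"

definition word_inv :: "'x word \<Rightarrow> 'x word" where
  "word_inv w = rev (map (\<lambda>(x, b). (x, \<not> b)) w)"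

definition word_pow :: "'x word \<Rightarrow> nat \<Rightarrow> 'x word" where
  "word_pow w n = concat (replicate n w)"

definition word_comm :: "'x word \<Rightarrow> 'x word \<Rightarrow> 'x word" where
  "word_comm u v = word_inv u @ word_inv v @ u @ v"

section \<open>Four groups in the family \<open>\<Phi>\<^sub>5\<close>\<close>

datatype phi5_gen = A1 | A2 | A3 | A4 | B

definition phi5_common :: "nat \<Rightarrow> (phi5_gen word \<times> phi5_gen word) set" where
  "phi5_common p =
    {(word_comm (gen A1) (gen A2), gen B),
     (word_comm (gen A3) (gen A4), gen B),
     (word_pow (gen B) p, [])} \<union>
    {(word_comm (gen x) (gen y), []) | x y. {x, y} \<noteq> {A1, A2} \<and> {x, y} \<noteq> {A3, A4}}"

definition Phi5_3111 :: "nat \<Rightarrow> phi5_gen word set monoid" where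
  "Phi5_3111 p = presented_group (phi5_common p \<union>
    {(word_pow (gen A1) (p^2), gen B), (word_pow (gen A2) p, []),
     (word_pow (gen A3) p, []), (word_pow (gen A4) p, [])})"

definition Phi5_2211a :: "nat \<Rightarrow> phi5_gen word set monoid" where
  "Phi5_2211a p = presented_group (phi5_common p \<union>
    {(word_pow (gen A2) p, gen B), (word_pow (gen A1) (p^2), []),
     (word_pow (gen A3) p, []), (word_pow (gen A4) p, [])})"

definition Phi5_2211b :: "nat \<Rightarrow> phi5_gen word set monoid" where
  "Phi5_2211b p = presented_group (phi5_common p \<union>
    {(word_pow (gen A3) p, gen B), (word_pow (gen A1) (p^2), []),
     (word_pow (gen A2) p, []), (word_pow (gen A4) p, [])})"

definition Phi5_21111c :: "nat \<Rightarrow> phi5_gen word set monoid" where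
  "Phi5_21111c p = presented_group (phi5_common p \<union>
    {(word_pow (gen A1) (p^2), []), (word_pow (gen A2) p, []),
     (word_pow (gen A3) p, []), (word_pow (gen A4) p, [])})"

section \<open>The second cohomology group with trivial coefficients \<open>\<complex>\<^sup>\<times>\<close>\<close>

text \<open>
  Cochains are functions on \<open>carrier G \<times> carrier G\<close>. They are normalised to take the value
  \<open>1\<close> outside, so that each cochain is represented by exactly one HOL function and the group
  operation is the pointwise product.
\<close>

definition cocycles2 :: "('a, 'm) monoid_scheme \<Rightarrow> ('a \<Rightarrow> 'a \<Rightarrow> complex) set" where
  "cocycles2 G = {\<alpha>.
    (\<forall>g h. \<not> (g \<in> carrier G \<and> h \<in> carrier G) \<longrightarrow> \<alpha> g h = 1) \<and>
    (\<forall>g\<in>carrier G. \<forall>h\<in>carrier G. \<alpha> g h \<noteq> 0) \<and>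
    (\<forall>g\<in>carrier G. \<forall>h\<in>carrier G. \<forall>k\<in>carrier G.
      \<alpha> g h * \<alpha> (g \<otimes>\<^bsub>G\<^esub> h) k = \<alpha> h k * \<alpha> g (h \<otimes>\<^bsub>G\<^esub> k))}"

definition coboundaries2 :: "('a, 'm) monoid_scheme \<Rightarrow> ('a \<Rightarrow> 'a \<Rightarrow> complex) set" where
  "coboundaries2 G = {\<alpha>.
    (\<forall>g h. \<not> (g \<in> carrier G \<and> h \<in> carrier G) \<longrightarrow> \<alpha> g h = 1) \<and>
    (\<exists>c. (\<forall>g\<in>carrier G. c g \<noteq> 0) \<and>
      (\<forall>g\<in>carrier G. \<forall>h\<in>carrier G. \<alpha> g h = c g * c h / c (g \<otimes>\<^bsub>G\<^esub> h)))}"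

definition Z2 :: "('a, 'm) monoid_scheme \<Rightarrow> ('a \<Rightarrow> 'a \<Rightarrow> complex) monoid" where
  "Z2 G = \<lparr>carrier = cocycles2 G, mult = (\<lambda>\<alpha> \<beta> g h. \<alpha> g h * \<beta> g h), one = (\<lambda>g h. 1)\<rparr>"

definition H2 :: "('a, 'm) monoid_scheme \<Rightarrow> ('a \<Rightarrow> 'a \<Rightarrow> complex) set monoid" where
  "H2 G = Z2 G Mod coboundaries2 G"

section \<open>Twisted group algebras\<close>

text \<open>
  An element \<open>\<Sum>g. x g \<cdot> g\<close> is represented by its coefficient function \<open>x\<close>, which vanishes outside
  \<open>carrier G\<close>; the group is meant to be finite. Cocycles need not be normalised, hence the
  unit of the algebra is the basis vector of \<open>\<one>\<^bsub>G\<^esub>\<close> divided by \<open>\<alpha> \<one>\<^bsub>G\<^esub> \<one>\<^bsub>G\<^esub>\<close>.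
\<close>

definition twisted_group_algebra ::
  "('a, 'm) monoid_scheme \<Rightarrow> ('a \<Rightarrow> 'a \<Rightarrow> complex) \<Rightarrow> (complex, 'a \<Rightarrow> complex) module" where
  "twisted_group_algebra G \<alpha> =
    \<lparr>carrier = {x. \<forall>g. g \<notin> carrier G \<longrightarrow> x g = 0},
     mult = (\<lambda>x y k. \<Sum>(g, h)\<in>{(g, h). g \<in> carrier G \<and> h \<in> carrier G \<and> g \<otimes>\<^bsub>G\<^esub> h = k}.
               x g * y h * \<alpha> g h),
     one = (\<lambda>g. if g = \<one>\<^bsub>G\<^esub> then 1 / \<alpha> \<one>\<^bsub>G\<^esub> \<one>\<^bsub>G\<^esub> else 0),
     zero = (\<lambda>g. 0),
     add = (\<lambda>x y g. x g + y g),
     smult = (\<lambda>c x g. c * x g)\<rparr>"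

text \<open>
  Isomorphism of (unital, associative, not necessarily commutative) \<open>\<complex>\<close>-algebras. The library
  locale for algebras over a ring covers commutative algebras only.
\<close>

definition complex_algebra_iso ::
  "(complex, 'a, 'm) module_scheme \<Rightarrow> (complex, 'b, 'n) module_scheme \<Rightarrow> bool" where
  "complex_algebra_iso S T \<longleftrightarrow>
    (\<exists>\<phi>\<in>ring_iso S T. \<forall>c. \<forall>x\<in>carrier S. \<phi> (c \<odot>\<^bsub>S\<^esub> x) = c \<odot>\<^bsub>T\<^esub> \<phi> x)"

text \<open>
  An element of \<open>H2 G\<close> is a class, that is, a coset of the coboundaries; its members are the
  cocycles representing it.
\<close>

definition sim_C :: "('a, 'm) monoid_scheme \<Rightarrow> ('b, 'n) monoid_scheme \<Rightarrow> bool" where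
  "sim_C G H \<longleftrightarrow>
    (\<exists>\<psi>\<in>iso (H2 G) (H2 H). \<forall>X\<in>carrier (H2 G). \<forall>\<alpha>\<in>X. \<forall>\<beta>\<in>\<psi> X.
      complex_algebra_iso (twisted_group_algebra G \<alpha>) (twisted_group_algebra H \<beta>))"

end

theory Submission
  imports Defs "HOL-Algebra.Elementary_Groups"
begin

text \<open>
  Let \<open>A = \<int>/p\<^sup>2 \<times> (\<int>/p)\<^sup>3\<close> and let \<open>\<omega>\<close> be the bicharacter
  \<open>\<omega>(a, b) = \<zeta>\<close> to the power \<open>a\<^sub>1b\<^sub>2 + a\<^sub>3b\<^sub>4\<close>, where \<open>\<zeta>\<close> is a primitive \<open>p\<close>-th root
  of unity. Sending each generator to the corresponding basis vector of \<open>A\<close> together with a suitable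
  root of \<open>1\<close> or of \<open>\<zeta>\<close> embeds each of the four groups into the extension of \<open>A\<close> by
  \<open>\<complex>\<^sup>\<times>\<close> with cocycle \<open>\<omega>\<close>, and each of them is an extension \<open>\<pi>\<close> of \<open>A\<close> by the
  \<open>p\<close>-th roots of unity.

  Every cocycle of such a group \<open>G\<close> is cohomologous to one inflated from \<open>A\<close>: a central element of
  \<open>N = ker \<pi>\<close> is a commutator in each factor of a central product decomposition of \<open>G\<close>, so its
  lift to a central extension of \<open>G\<close> by \<open>\<complex>\<^sup>\<times>\<close> stays central. The inflation of \<open>\<eta>\<close>
  is a coboundary iff \<open>\<eta>\<close> is cohomologous to a power of \<open>\<omega>\<close>. Hence \<open>H\<^sup>2\<close> is the quotient of
  the cohomology of \<open>A\<close> by the class of \<open>\<omega>\<close>, for all four groups. Decomposing by the characters of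
  \<open>N\<close>, the twisted group algebra of the inflation of \<open>\<eta>\<close> is the direct sum over \<open>j < p\<close> of the
  twisted group algebras of \<open>A\<close> for \<open>\<eta>\<omega>\<^sup>j\<close>, which no longer depends on the group.
\<close>

section \<open>Homomorphisms out of a presented group\<close>

lemma equiv_word_rel: "equiv UNIV (word_rel R)"
proof (rule equivI)
  show "refl (word_rel R)"
    by (rule refl_onI) (simp add: word_rel_def equivclp_def)
  show "sym (word_rel R)"
    by (rule symI) (simp add: word_rel_def equivclp_sym)
  show "trans (word_rel R)"
    by (rule transI) (auto simp: word_rel_def intro: transpD[OF transp_equivclp])
qed auto

lemma word_step_append: "word_step R u v \<Longrightarrow> word_step R (a @ u @ b) (a @ v @ b)"
proof (induction rule: word_step.induct)
  case (cancel u x c v)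
  then show ?case
    using word_step.cancel[of R "a @ u" x c "v @ b"] by simp
next
  case (relation r s u v)
  then show ?case
    using word_step.relation[of r s R "a @ u" "v @ b"] by simp
qed

lemma word_rel_append_both: "(u, v) \<in> word_rel R \<Longrightarrow> (a @ u @ b, a @ v @ b) \<in> word_rel R"
proof -
  assume "(u, v) \<in> word_rel R"
  then have "equivclp (word_step R) u v" by (simp add: word_rel_def)
  then have "equivclp (word_step R) (a @ u @ b) (a @ v @ b)"
  proof (induction rule: equivclp_induct)
    case base
    then show ?case by (simp add: equivclp_def)
  next
    case (step y z)
    from step.hyps(2) have "equivclp (word_step R) (a @ y @ b) (a @ z @ b)"
      by (auto simp: equivclp_def symclp_def intro!: r_into_rtranclp word_step_append)
    then show ?case using step.IH transpD[OF transp_equivclp] by metis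
  qed
  then show ?thesis by (simp add: word_rel_def)
qed

lemma word_rel_append:
  assumes "(u, u') \<in> word_rel R" "(v, v') \<in> word_rel R"
  shows "(u @ v, u' @ v') \<in> word_rel R"
  using word_rel_append_both[OF assms(1), of "[]" v] word_rel_append_both[OF assms(2), of u' "[]"]
    equivE[OF equiv_word_rel[of R]] by (simp, meson transD)

lemma presented_group_mult:
  "(word_rel R `` {u}) \<otimes>\<^bsub>presented_group R\<^esub> (word_rel R `` {v}) = word_rel R `` {u @ v}"
proof -
  have "congruent2 (word_rel R) (word_rel R) (\<lambda>u v. word_rel R `` {u @ v})"
    by (intro congruent2I' equiv_class_eq[OF equiv_word_rel] word_rel_append)
  then show ?thesis
    by (simp add: presented_group_def
        UN_equiv_class2[OF equiv_word_rel[of R] equiv_word_rel[of R], simplified])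
qed

section \<open>Evaluation of words in a group\<close>

definition word_eval :: "('a, 'm) monoid_scheme \<Rightarrow> ('x \<Rightarrow> 'a) \<Rightarrow> 'x word \<Rightarrow> 'a" where
  "word_eval M \<rho> w =
    foldr (\<lambda>(x, b) y. (if b then \<rho> x else inv\<^bsub>M\<^esub> \<rho> x) \<otimes>\<^bsub>M\<^esub> y) w \<one>\<^bsub>M\<^esub>"

context group
begin

context
  fixes \<rho> :: "'x \<Rightarrow> 'a"
  assumes gens: "\<And>x. \<rho> x \<in> carrier G"
begin

lemma word_eval_closed: "word_eval G \<rho> w \<in> carrier G"
  by (induction w) (auto simp: word_eval_def gens)

lemma word_eval_Nil: "word_eval G \<rho> [] = \<one>"
  by (simp add: word_eval_def)

lemma word_eval_Cons:
  "word_eval G \<rho> ((x, b) # w) = (if b then \<rho> x else inv \<rho> x) \<otimes> word_eval G \<rho> w"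
  by (simp add: word_eval_def)

lemma word_eval_append: "word_eval G \<rho> (u @ v) = word_eval G \<rho> u \<otimes> word_eval G \<rho> v"
  by (induction u) (auto simp: word_eval_Nil word_eval_Cons word_eval_closed gens m_assoc)

lemma word_eval_gen: "word_eval G \<rho> (gen x) = \<rho> x"
  by (simp add: gen_def word_eval_Nil word_eval_Cons gens)

lemma word_eval_word_inv: "word_eval G \<rho> (word_inv w) = inv (word_eval G \<rho> w)"
  by (induction w)
    (auto simp: word_inv_def word_eval_Nil word_eval_Cons word_eval_append word_eval_closed
      gens inv_mult_group)

lemma word_eval_word_pow: "word_eval G \<rho> (word_pow w n) = word_eval G \<rho> w [^] n"
proof (induction n)
  case 0
  then show ?case by (simp add: word_pow_def word_eval_Nil)
next
  case (Suc n)
  then show ?case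
    using nat_pow_Suc2[OF word_eval_closed, of w n] by (simp add: word_pow_def word_eval_append)
qed

text \<open>Commutator relations are tested in the form \<open>u v = v u s\<close>, so that
  verifying them in a cocycle extension requires no computation of inverses.\<close>

lemma word_eval_word_comm:
  assumes "word_eval G \<rho> u \<otimes> word_eval G \<rho> v = word_eval G \<rho> v \<otimes> word_eval G \<rho> u \<otimes> s"
    and "s \<in> carrier G"
  shows "word_eval G \<rho> (word_comm u v) = s"
proof -
  let ?u = "word_eval G \<rho> u" and ?v = "word_eval G \<rho> v"
  have "word_eval G \<rho> (word_comm u v) = inv ?u \<otimes> (inv ?v \<otimes> (?u \<otimes> ?v))"
    by (simp add: word_comm_def word_eval_append word_eval_word_inv)
  also have "\<dots> = s"
    unfolding assms(1) using assms(2) word_eval_closed by (simp add: m_assoc inv_solve_left')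
  finally show ?thesis .
qed

lemma word_eval_word_step:
  assumes "\<And>r s. (r, s) \<in> R \<Longrightarrow> word_eval G \<rho> r = word_eval G \<rho> s"
    and "word_step R u v"
  shows "word_eval G \<rho> u = word_eval G \<rho> v"
  using assms(2)
proof cases
  case (cancel u' x b v')
  then show ?thesis
    by (cases b) (simp_all add: word_eval_append word_eval_Cons gens word_eval_closed inv_solve_left inv_solve_left' m_assoc[symmetric])
next
  case (relation r s u' v')
  then show ?thesis using assms(1) by (simp add: word_eval_append)
qed

lemma word_eval_word_rel:
  assumes "\<And>r s. (r, s) \<in> R \<Longrightarrow> word_eval G \<rho> r = word_eval G \<rho> s"
    and "(u, v) \<in> word_rel R"
  shows "word_eval G \<rho> u = word_eval G \<rho> v"
proof -
  from assms(2) have "equivclp (word_step R) u v" by (simp add: word_rel_def)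
  then show ?thesis
  proof (induction rule: equivclp_induct)
    case (step y z)
    then show ?case using word_eval_word_step[of R, OF assms(1)] by metis
  qed simp
qed

text \<open>Evaluation is constant on the classes of \<open>word_rel\<close> and so descends to them
  (von Dyck's theorem). The image is known to contain the value of every word, which later yields
  surjectivity onto the base and onto the roots of unity.\<close>

lemma presented_group_hom:
  assumes "\<And>r s. (r, s) \<in> R \<Longrightarrow> word_eval G \<rho> r = word_eval G \<rho> s"
  obtains \<phi> where "\<phi> \<in> hom (presented_group R) G"
    and "\<And>w. word_eval G \<rho> w \<in> \<phi> ` carrier (presented_group R)"
proof
  define \<phi> where "\<phi> U = word_eval G \<rho> (SOME w. w \<in> U)" for U
  have \<phi>: "\<phi> (word_rel R `` {w}) = word_eval G \<rho> w" for w
  proof -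
    have "w \<in> word_rel R `` {w}" using equiv_class_self[OF equiv_word_rel] by auto
    then have "(SOME v. v \<in> word_rel R `` {w}) \<in> word_rel R `` {w}" by (rule someI)
    then show ?thesis
      unfolding \<phi>_def using word_eval_word_rel[of R, OF assms] by fastforce
  qed
  have carr: "U \<in> carrier (presented_group R) \<longleftrightarrow> (\<exists>w. U = word_rel R `` {w})" for U
    by (auto simp: presented_group_def quotient_def)
  show "\<phi> \<in> hom (presented_group R) G"
    by (rule homI) (auto simp: carr \<phi> word_eval_closed presented_group_mult word_eval_append)
  show "word_eval G \<rho> w \<in> \<phi> ` carrier (presented_group R)" for w
    using \<phi>[of w] carr by (metis image_eqI)
qed

end

end

section \<open>Cocycles and cocycle extensions\<close>

lemma cocycles2_eq:
  "\<lbrakk>\<alpha> \<in> cocycles2 G; g \<in> carrier G; h \<in> carrier G; k \<in> carrier G\<rbrakk>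
    \<Longrightarrow> \<alpha> g h * \<alpha> (g \<otimes>\<^bsub>G\<^esub> h) k = \<alpha> h k * \<alpha> g (h \<otimes>\<^bsub>G\<^esub> k)"
  by (auto simp: cocycles2_def)

lemma cocycles2_nonzero: "\<alpha> \<in> cocycles2 G \<Longrightarrow> \<alpha> g h \<noteq> 0"
  by (cases "g \<in> carrier G \<and> h \<in> carrier G") (auto simp: cocycles2_def)

lemma cocycles2_outside: "\<alpha> \<in> cocycles2 G \<Longrightarrow> g \<notin> carrier G \<or> h \<notin> carrier G \<Longrightarrow> \<alpha> g h = 1"
  by (auto simp: cocycles2_def)

context group
begin

lemma cocycles2_one_left:
  assumes "\<alpha> \<in> cocycles2 G" "g \<in> carrier G"
  shows "\<alpha> \<one> g = \<alpha> \<one> \<one>"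
  using cocycles2_eq[OF assms(1), of \<one> \<one> g] assms cocycles2_nonzero[OF assms(1), of \<one> g] by auto

lemma cocycles2_one_right:
  assumes "\<alpha> \<in> cocycles2 G" "g \<in> carrier G"
  shows "\<alpha> g \<one> = \<alpha> \<one> \<one>"
  using cocycles2_eq[OF assms(1), of g \<one> \<one>] assms cocycles2_nonzero[OF assms(1), of g \<one>] by auto

end

text \<open>The central extension of \<open>G\<close> by \<open>\<complex>\<^sup>\<times>\<close>:
  the pair \<open>(g, x)\<close> stands for \<open>x\<close> times the basis vector of
  \<open>g\<close> in the twisted group algebra. As in that algebra, the identity carries the factor
  \<open>1 / \<alpha> \<one> \<one>\<close> because cocycles are not normalised.\<close>

definition cocycle_extension ::
  "('a, 'm) monoid_scheme \<Rightarrow> ('a \<Rightarrow> 'a \<Rightarrow> complex) \<Rightarrow> ('a \<times> complex) monoid" where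
  "cocycle_extension G \<alpha> =
    \<lparr>carrier = carrier G \<times> (UNIV - {0}),
     mult = (\<lambda>(g, x) (h, y). (g \<otimes>\<^bsub>G\<^esub> h, x * y * \<alpha> g h)),
     one = (\<one>\<^bsub>G\<^esub>, 1 / \<alpha> \<one>\<^bsub>G\<^esub> \<one>\<^bsub>G\<^esub>)\<rparr>"

lemma carrier_cocycle_extension [simp]:
  "(g, x) \<in> carrier (cocycle_extension G \<alpha>) \<longleftrightarrow> g \<in> carrier G \<and> x \<noteq> 0"
  by (simp add: cocycle_extension_def)

lemma mult_cocycle_extension [simp]:
  "(g, x) \<otimes>\<^bsub>cocycle_extension G \<alpha>\<^esub> (h, y) = (g \<otimes>\<^bsub>G\<^esub> h, x * y * \<alpha> g h)"
  by (simp add: cocycle_extension_def)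

lemma one_cocycle_extension [simp]:
  "\<one>\<^bsub>cocycle_extension G \<alpha>\<^esub> = (\<one>\<^bsub>G\<^esub>, 1 / \<alpha> \<one>\<^bsub>G\<^esub> \<one>\<^bsub>G\<^esub>)"
  by (simp add: cocycle_extension_def)

lemma (in group) group_cocycle_extension:
  assumes \<alpha>: "\<alpha> \<in> cocycles2 G"
  shows "group (cocycle_extension G \<alpha>)"
proof (rule groupI; clarify?)
  note nz = cocycles2_nonzero[OF \<alpha>]
  show "\<one>\<^bsub>cocycle_extension G \<alpha>\<^esub> \<in> carrier (cocycle_extension G \<alpha>)"
    using nz by simp
  fix g x assume gx: "(g, x) \<in> carrier (cocycle_extension G \<alpha>)"
  then have g: "g \<in> carrier G" "x \<noteq> 0" by auto
  show "\<one>\<^bsub>cocycle_extension G \<alpha>\<^esub> \<otimes>\<^bsub>cocycle_extension G \<alpha>\<^esub> (g, x) = (g, x)"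
    using g nz cocycles2_one_left[OF \<alpha> g(1)] by simp
  \<comment> \<open>The scalar of the inverse is solved for so that the product has scalar
    \<open>1 / \<alpha> \<one> \<one>\<close>, the one of the identity.\<close>
  have "(inv g, 1 / (x * \<alpha> (inv g) g * \<alpha> \<one> \<one>)) \<otimes>\<^bsub>cocycle_extension G \<alpha>\<^esub> (g, x)
      = \<one>\<^bsub>cocycle_extension G \<alpha>\<^esub>"
    using g nz by simp
  moreover have "(inv g, 1 / (x * \<alpha> (inv g) g * \<alpha> \<one> \<one>)) \<in> carrier (cocycle_extension G \<alpha>)"
    using g nz by simp
  ultimately show "\<exists>y\<in>carrier (cocycle_extension G \<alpha>).
      y \<otimes>\<^bsub>cocycle_extension G \<alpha>\<^esub> (g, x) = \<one>\<^bsub>cocycle_extension G \<alpha>\<^esub>"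
    by blast
  fix h y assume hy: "(h, y) \<in> carrier (cocycle_extension G \<alpha>)"
  then have h: "h \<in> carrier G" "y \<noteq> 0" by auto
  show "(g, x) \<otimes>\<^bsub>cocycle_extension G \<alpha>\<^esub> (h, y) \<in> carrier (cocycle_extension G \<alpha>)"
    using g h nz by simp
  fix k z assume kz: "(k, z) \<in> carrier (cocycle_extension G \<alpha>)"
  then have k: "k \<in> carrier G" "z \<noteq> 0" by auto
  show "(g, x) \<otimes>\<^bsub>cocycle_extension G \<alpha>\<^esub> (h, y) \<otimes>\<^bsub>cocycle_extension G \<alpha>\<^esub> (k, z)
      = (g, x) \<otimes>\<^bsub>cocycle_extension G \<alpha>\<^esub> ((h, y) \<otimes>\<^bsub>cocycle_extension G \<alpha>\<^esub> (k, z))"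
    using cocycles2_eq[OF \<alpha> g(1) h(1) k(1)] g h k by (simp add: m_assoc mult_ac)
qed

text \<open>The action of the central scalars, written as a map on pairs instead of a product with a
  central element, so that scalars move out of products by plain rewriting.\<close>

definition scale :: "complex \<Rightarrow> 'a \<times> complex \<Rightarrow> 'a \<times> complex" where
  "scale c X = (fst X, c * snd X)"

lemma scale_mult_left:
  "scale c X \<otimes>\<^bsub>cocycle_extension G \<alpha>\<^esub> Y = scale c (X \<otimes>\<^bsub>cocycle_extension G \<alpha>\<^esub> Y)"
  by (cases X; cases Y) (simp add: scale_def)

lemma scale_mult_right:
  "X \<otimes>\<^bsub>cocycle_extension G \<alpha>\<^esub> scale c Y = scale c (X \<otimes>\<^bsub>cocycle_extension G \<alpha>\<^esub> Y)"
  by (cases X; cases Y) (simp add: scale_def)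

lemma scale_scale: "scale c (scale d X) = scale (c * d) X"
  by (simp add: scale_def mult.assoc)

lemma scale_cancel: "c \<noteq> 0 \<Longrightarrow> scale c X = scale c Y \<longleftrightarrow> X = Y"
  by (auto simp: scale_def prod_eq_iff)

text \<open>In the extension, lifts of commuting elements commute up to a scalar, so a lift of \<open>g\<close>
  commutes with the commutator of lifts of \<open>u\<close> and \<open>v\<close>.\<close>

lemma (in group) cocycle_commute:
  assumes \<alpha>: "\<alpha> \<in> cocycles2 G"
    and carr: "g \<in> carrier G" "u \<in> carrier G" "v \<in> carrier G" "n \<in> carrier G"
    and gu: "g \<otimes> u = u \<otimes> g" and gv: "g \<otimes> v = v \<otimes> g"
    and uv: "u \<otimes> v = n \<otimes> (v \<otimes> u)"
  shows "\<alpha> g n = \<alpha> n g"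
proof -
  let ?E = "cocycle_extension G \<alpha>"
  interpret E: group ?E by (rule group_cocycle_extension[OF \<alpha>])
  note nz = cocycles2_nonzero[OF \<alpha>]
  define lift where "lift x = (x, 1::complex)" for x :: 'a
  let ?g = "lift g" and ?u = "lift u" and ?v = "lift v" and ?n = "lift n"
  note sc = scale_mult_left scale_mult_right scale_scale
  have carrE: "?g \<in> carrier ?E" "?u \<in> carrier ?E" "?v \<in> carrier ?E" "?n \<in> carrier ?E"
    using carr by (auto simp: lift_def)
  have ex: "\<exists>s. s \<noteq> 0 \<and> X = scale s Y"
    if "fst X = fst Y" "X \<in> carrier ?E" "Y \<in> carrier ?E" for X Y
    using that by (intro exI[of _ "snd X / snd Y"]) (auto simp: scale_def cocycle_extension_def)
  have "\<exists>s. s \<noteq> 0 \<and> ?g \<otimes>\<^bsub>?E\<^esub> ?u = scale s (?u \<otimes>\<^bsub>?E\<^esub> ?g)"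
    using carrE gu by (intro ex E.m_closed) (auto simp: lift_def)
  then obtain s1 where s1: "s1 \<noteq> 0" "?g \<otimes>\<^bsub>?E\<^esub> ?u = scale s1 (?u \<otimes>\<^bsub>?E\<^esub> ?g)"
    by blast
  have "\<exists>s. s \<noteq> 0 \<and> ?g \<otimes>\<^bsub>?E\<^esub> ?v = scale s (?v \<otimes>\<^bsub>?E\<^esub> ?g)"
    using carrE gv by (intro ex E.m_closed) (auto simp: lift_def)
  then obtain s2 where s2: "s2 \<noteq> 0" "?g \<otimes>\<^bsub>?E\<^esub> ?v = scale s2 (?v \<otimes>\<^bsub>?E\<^esub> ?g)"
    by blast
  have "\<exists>s. s \<noteq> 0 \<and> ?u \<otimes>\<^bsub>?E\<^esub> ?v = scale s (?n \<otimes>\<^bsub>?E\<^esub> (?v \<otimes>\<^bsub>?E\<^esub> ?u))"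
    using carrE uv by (intro ex E.m_closed) (auto simp: lift_def)
  then obtain s3 where s3: "s3 \<noteq> 0" "?u \<otimes>\<^bsub>?E\<^esub> ?v = scale s3 (?n \<otimes>\<^bsub>?E\<^esub> (?v \<otimes>\<^bsub>?E\<^esub> ?u))"
    by blast
  \<comment> \<open>Moving the lift of \<open>g\<close> past \<open>u v\<close> and past
    \<open>v u\<close> costs the same factor \<open>s1 * s2\<close>. Since these two products differ
    by the lift of \<open>n\<close> and a scalar, moving past that lift costs nothing.\<close>
  have swap: "?g \<otimes>\<^bsub>?E\<^esub> (?u \<otimes>\<^bsub>?E\<^esub> ?v) = scale (s1 * s2) (?u \<otimes>\<^bsub>?E\<^esub> ?v \<otimes>\<^bsub>?E\<^esub> ?g)"
    using carrE by (simp add: E.m_assoc[symmetric] s1 sc) (simp add: E.m_assoc s2 sc)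
  have swap': "?g \<otimes>\<^bsub>?E\<^esub> (?v \<otimes>\<^bsub>?E\<^esub> ?u) = scale (s1 * s2) (?v \<otimes>\<^bsub>?E\<^esub> ?u \<otimes>\<^bsub>?E\<^esub> ?g)"
    using carrE by (simp add: E.m_assoc[symmetric] s2 sc) (simp add: E.m_assoc s1 sc mult.commute)
  have "scale s3 (?g \<otimes>\<^bsub>?E\<^esub> ?n \<otimes>\<^bsub>?E\<^esub> (?v \<otimes>\<^bsub>?E\<^esub> ?u)) = ?g \<otimes>\<^bsub>?E\<^esub> (?u \<otimes>\<^bsub>?E\<^esub> ?v)"
    using carrE by (simp add: s3 sc E.m_assoc)
  also have "\<dots> = scale (s1 * s2 * s3) (?n \<otimes>\<^bsub>?E\<^esub> (?v \<otimes>\<^bsub>?E\<^esub> ?u \<otimes>\<^bsub>?E\<^esub> ?g))"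
    unfolding swap unfolding s3(2) sc using carrE by (simp add: E.m_assoc mult_ac)
  also have "\<dots> = scale s3 (?n \<otimes>\<^bsub>?E\<^esub> ?g \<otimes>\<^bsub>?E\<^esub> (?v \<otimes>\<^bsub>?E\<^esub> ?u))"
    using carrE by (simp add: swap' sc E.m_assoc mult.commute)
  finally have "?g \<otimes>\<^bsub>?E\<^esub> ?n \<otimes>\<^bsub>?E\<^esub> (?v \<otimes>\<^bsub>?E\<^esub> ?u) = ?n \<otimes>\<^bsub>?E\<^esub> ?g \<otimes>\<^bsub>?E\<^esub> (?v \<otimes>\<^bsub>?E\<^esub> ?u)"
    using s3 by (simp add: scale_cancel)
  then have "?g \<otimes>\<^bsub>?E\<^esub> ?n = ?n \<otimes>\<^bsub>?E\<^esub> ?g"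
    using carrE by (meson E.m_closed E.right_cancel)
  then show ?thesis by (simp add: lift_def)
qed

section \<open>The group of cocycles and the subgroup of coboundaries\<close>

lemma carrier_Z2 [simp]: "carrier (Z2 G) = cocycles2 G"
  and mult_Z2 [simp]: "\<alpha> \<otimes>\<^bsub>Z2 G\<^esub> \<beta> = (\<lambda>g h. \<alpha> g h * \<beta> g h)"
  and one_Z2 [simp]: "\<one>\<^bsub>Z2 G\<^esub> = (\<lambda>g h. 1)"
  by (simp_all add: Z2_def)

lemma cocycles2_mult:
  assumes "\<alpha> \<in> cocycles2 G" "\<beta> \<in> cocycles2 G"
  shows "(\<lambda>g h. \<alpha> g h * \<beta> g h) \<in> cocycles2 G"
proof -
  have "\<alpha> g h * \<beta> g h * (\<alpha> (g \<otimes>\<^bsub>G\<^esub> h) k * \<beta> (g \<otimes>\<^bsub>G\<^esub> h) k)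
      = \<alpha> h k * \<beta> h k * (\<alpha> g (h \<otimes>\<^bsub>G\<^esub> k) * \<beta> g (h \<otimes>\<^bsub>G\<^esub> k))"
    if "g \<in> carrier G" "h \<in> carrier G" "k \<in> carrier G" for g h k
    using arg_cong2[OF cocycles2_eq[OF assms(1) that] cocycles2_eq[OF assms(2) that], of times]
    by (simp add: mult_ac)
  then show ?thesis
    using assms unfolding cocycles2_def by auto
qed

lemma cocycles2_inverse:
  assumes "\<alpha> \<in> cocycles2 G"
  shows "(\<lambda>g h. inverse (\<alpha> g h)) \<in> cocycles2 G"
proof -
  have "inverse (\<alpha> g h) * inverse (\<alpha> (g \<otimes>\<^bsub>G\<^esub> h) k)
      = inverse (\<alpha> h k) * inverse (\<alpha> g (h \<otimes>\<^bsub>G\<^esub> k))"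
    if "g \<in> carrier G" "h \<in> carrier G" "k \<in> carrier G" for g h k
    using cocycles2_eq[OF assms that] by (metis inverse_mult_distrib)
  then show ?thesis
    using assms unfolding cocycles2_def by auto
qed

lemma comm_group_Z2: "comm_group (Z2 G)"
proof (rule comm_groupI)
  show "\<exists>\<beta>\<in>carrier (Z2 G). \<beta> \<otimes>\<^bsub>Z2 G\<^esub> \<alpha> = \<one>\<^bsub>Z2 G\<^esub>" if "\<alpha> \<in> carrier (Z2 G)" for \<alpha>
    using that cocycles2_inverse[of \<alpha> G] cocycles2_nonzero[of \<alpha> G]
    by (intro bexI[of _ "\<lambda>g h. inverse (\<alpha> g h)"]) auto
qed (auto simp: cocycles2_mult mult_ac cocycles2_def)

definition coboundary :: "('a, 'm) monoid_scheme \<Rightarrow> ('a \<Rightarrow> complex) \<Rightarrow> 'a \<Rightarrow> 'a \<Rightarrow> complex" where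
  "coboundary G c g h = (if g \<in> carrier G \<and> h \<in> carrier G then c g * c h / c (g \<otimes>\<^bsub>G\<^esub> h) else 1)"

context group
begin

lemma coboundaries2_eq:
  "coboundaries2 G = {coboundary G c | c. \<forall>g\<in>carrier G. c g \<noteq> 0}"
  by (auto simp: coboundaries2_def coboundary_def fun_eq_iff)

lemma coboundary_in_cocycles2:
  assumes "\<And>g. g \<in> carrier G \<Longrightarrow> c g \<noteq> 0"
  shows "coboundary G c \<in> cocycles2 G"
  using assms by (auto simp: cocycles2_def coboundary_def m_assoc field_simps)

lemma coboundaries2_subgroup: "subgroup (coboundaries2 G) (Z2 G)"
proof (rule group.subgroupI)
  show "group (Z2 G)" by (rule comm_group.axioms(2)[OF comm_group_Z2])
  show "coboundaries2 G \<subseteq> carrier (Z2 G)"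
    by (auto simp: coboundaries2_eq coboundary_in_cocycles2)
  have "coboundary G (\<lambda>g. 1) \<in> coboundaries2 G" unfolding coboundaries2_eq by force
  then show "coboundaries2 G \<noteq> {}" by blast
next
  fix \<alpha> assume "\<alpha> \<in> coboundaries2 G"
  then obtain c where c: "\<alpha> = coboundary G c" "\<forall>g\<in>carrier G. c g \<noteq> 0"
    by (auto simp: coboundaries2_eq)
  have "inv\<^bsub>Z2 G\<^esub> \<alpha> = coboundary G (\<lambda>g. inverse (c g))"
    using c coboundary_in_cocycles2[of c] coboundary_in_cocycles2[of "\<lambda>g. inverse (c g)"]
    by (intro group.inv_equality[OF comm_group.axioms(2)[OF comm_group_Z2]])
      (simp_all, auto simp: coboundary_def fun_eq_iff field_simps)
  then show "inv\<^bsub>Z2 G\<^esub> \<alpha> \<in> coboundaries2 G"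
    using c by (auto simp: coboundaries2_eq)
next
  fix \<alpha> \<beta> assume "\<alpha> \<in> coboundaries2 G" "\<beta> \<in> coboundaries2 G"
  then obtain c d where c: "\<alpha> = coboundary G c" "\<forall>g\<in>carrier G. c g \<noteq> 0"
    and d: "\<beta> = coboundary G d" "\<forall>g\<in>carrier G. d g \<noteq> 0"
    by (auto simp: coboundaries2_eq)
  have "\<alpha> \<otimes>\<^bsub>Z2 G\<^esub> \<beta> = coboundary G (\<lambda>g. c g * d g)"
    using c d by (auto simp: coboundary_def fun_eq_iff)
  then show "\<alpha> \<otimes>\<^bsub>Z2 G\<^esub> \<beta> \<in> coboundaries2 G"
    using c d by (auto simp: coboundaries2_eq intro!: exI[of _ "\<lambda>g. c g * d g"])
qed

lemma coboundaries2_normal: "coboundaries2 G \<lhd> Z2 G"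
  by (rule comm_group.normal_iff_subgroup[OF comm_group_Z2, THEN iffD2, OF coboundaries2_subgroup])

lemma group_H2: "group (H2 G)"
  unfolding H2_def by (rule normal.factorgroup_is_group[OF coboundaries2_normal])

end

section \<open>Twisted group algebras\<close>

lemma complex_algebra_iso_trans:
  assumes "complex_algebra_iso S T" "complex_algebra_iso T U"
  shows "complex_algebra_iso S U"
proof -
  obtain \<phi> where \<phi>: "\<phi> \<in> ring_iso S T" "\<And>c x. x \<in> carrier S \<Longrightarrow> \<phi> (c \<odot>\<^bsub>S\<^esub> x) = c \<odot>\<^bsub>T\<^esub> \<phi> x"
    using assms(1) by (auto simp: complex_algebra_iso_def)
  obtain \<chi> where \<chi>: "\<chi> \<in> ring_iso T U" "\<And>c x. x \<in> carrier T \<Longrightarrow> \<chi> (c \<odot>\<^bsub>T\<^esub> x) = c \<odot>\<^bsub>U\<^esub> \<chi> x"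
    using assms(2) by (auto simp: complex_algebra_iso_def)
  have "\<phi> x \<in> carrier T" if "x \<in> carrier S" for x
    using that \<phi>(1) by (auto simp: ring_iso_def ring_hom_def)
  then show ?thesis
    unfolding complex_algebra_iso_def
    using \<phi> \<chi> by (intro bexI[OF _ ring_iso_set_trans[OF \<phi>(1) \<chi>(1)]]) auto
qed

text \<open>Every element of \<open>T\<close> is an image under the isomorphism, so operations on
  \<open>T\<close> are images of operations on \<open>S\<close>. Closure of the latter is what
  allows the inverse map to be evaluated on the results.\<close>

lemma complex_algebra_iso_sym:
  assumes iso: "complex_algebra_iso S T"
    and closed: "\<one>\<^bsub>S\<^esub> \<in> carrier S"
      "\<And>x y. \<lbrakk>x \<in> carrier S; y \<in> carrier S\<rbrakk> \<Longrightarrow> x \<otimes>\<^bsub>S\<^esub> y \<in> carrier S"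
      "\<And>x y. \<lbrakk>x \<in> carrier S; y \<in> carrier S\<rbrakk> \<Longrightarrow> x \<oplus>\<^bsub>S\<^esub> y \<in> carrier S"
      "\<And>c x. x \<in> carrier S \<Longrightarrow> c \<odot>\<^bsub>S\<^esub> x \<in> carrier S"
  shows "complex_algebra_iso T S"
proof -
  obtain \<phi> where \<phi>: "\<phi> \<in> ring_hom S T" "bij_betw \<phi> (carrier S) (carrier T)"
      "\<And>c x. x \<in> carrier S \<Longrightarrow> \<phi> (c \<odot>\<^bsub>S\<^esub> x) = c \<odot>\<^bsub>T\<^esub> \<phi> x"
    using iso by (auto simp: complex_algebra_iso_def ring_iso_def)
  define \<chi> where "\<chi> = inv_into (carrier S) \<phi>"
  have inj: "inj_on \<phi> (carrier S)" and img: "carrier T = \<phi> ` carrier S"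
    using \<phi>(2) by (auto simp: bij_betw_def)
  have \<chi>: "\<chi> (\<phi> x) = x" if "x \<in> carrier S" for x
    using that inj by (simp add: \<chi>_def)
  have hom: "\<phi> x \<otimes>\<^bsub>T\<^esub> \<phi> y = \<phi> (x \<otimes>\<^bsub>S\<^esub> y)" "\<phi> x \<oplus>\<^bsub>T\<^esub> \<phi> y = \<phi> (x \<oplus>\<^bsub>S\<^esub> y)"
    if "x \<in> carrier S" "y \<in> carrier S" for x y
    using that \<phi>(1) by (auto simp: ring_hom_def)
  have one: "\<one>\<^bsub>T\<^esub> = \<phi> \<one>\<^bsub>S\<^esub>" using \<phi>(1) by (simp add: ring_hom_def)
  have "bij_betw \<chi> (carrier T) (carrier S)"
    unfolding \<chi>_def by (rule bij_betw_inv_into[OF \<phi>(2)])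
  moreover have "\<chi> \<in> ring_hom T S"
    unfolding ring_hom_def by (auto simp: img \<chi> hom one closed)
  moreover have "\<chi> (c \<odot>\<^bsub>T\<^esub> y) = c \<odot>\<^bsub>S\<^esub> \<chi> y" if "y \<in> carrier T" for c y
    using that by (auto simp: img \<chi> \<phi>(3)[symmetric] closed)
  ultimately show ?thesis
    unfolding complex_algebra_iso_def ring_iso_def by blast
qed

lemma (in monoid) twisted_group_algebra_sym:
  assumes "complex_algebra_iso (twisted_group_algebra G \<alpha>) T"
  shows "complex_algebra_iso T (twisted_group_algebra G \<alpha>)"
proof (rule complex_algebra_iso_sym[OF assms])
  fix x y assume "x \<in> carrier (twisted_group_algebra G \<alpha>)" "y \<in> carrier (twisted_group_algebra G \<alpha>)"
  \<comment> \<open>Outside the carrier the sum defining a product is empty, so the product vanishes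
    there.\<close>
  have "{(g, h). g \<in> carrier G \<and> h \<in> carrier G \<and> g \<otimes> h = k} = {}" if "k \<notin> carrier G" for k
    using that by auto
  then show "x \<otimes>\<^bsub>twisted_group_algebra G \<alpha>\<^esub> y \<in> carrier (twisted_group_algebra G \<alpha>)"
    by (simp add: twisted_group_algebra_def del: Collect_empty_eq)
qed (auto simp: twisted_group_algebra_def)

text \<open>Dividing the basis vector of each \<open>g\<close> by \<open>c g\<close> turns the
  multiplication by \<open>\<alpha>\<close> into that by the cohomologous cocycle.\<close>

lemma (in group) twisted_group_algebra_cohomologous:
  assumes c: "\<And>g. g \<in> carrier G \<Longrightarrow> c g \<noteq> 0" and \<alpha>: "\<alpha> \<in> cocycles2 G"
  shows "complex_algebra_iso (twisted_group_algebra G \<alpha>)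
    (twisted_group_algebra G (\<lambda>g h. \<alpha> g h * coboundary G c g h))"
proof -
  define \<phi> where "\<phi> x = (\<lambda>g. x g / c g)" for x :: "'a \<Rightarrow> complex"
  let ?S = "twisted_group_algebra G \<alpha>"
  let ?T = "twisted_group_algebra G (\<lambda>g h. \<alpha> g h * coboundary G c g h)"
  have carr: "carrier ?T = carrier ?S" by (simp add: twisted_group_algebra_def)
  have "bij_betw \<phi> (carrier ?S) (carrier ?T)"
    by (rule bij_betw_byWitness[where f' = "\<lambda>x g. x g * c g"])
      (use c in \<open>auto simp: \<phi>_def twisted_group_algebra_def fun_eq_iff\<close>)
  moreover have "\<phi> \<in> ring_hom ?S ?T"
  proof (rule ring_hom_memI)
    show "\<phi> (x \<otimes>\<^bsub>?S\<^esub> y) = \<phi> x \<otimes>\<^bsub>?T\<^esub> \<phi> y" for x y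
      using c by (auto simp: \<phi>_def twisted_group_algebra_def fun_eq_iff sum_divide_distrib coboundary_def
          intro!: sum.cong)
    show "\<phi> \<one>\<^bsub>?S\<^esub> = \<one>\<^bsub>?T\<^esub>"
      using c by (auto simp: \<phi>_def twisted_group_algebra_def fun_eq_iff coboundary_def)
  qed (auto simp: \<phi>_def twisted_group_algebra_def fun_eq_iff add_divide_distrib)
  moreover have "\<phi> (a \<odot>\<^bsub>?S\<^esub> x) = a \<odot>\<^bsub>?T\<^esub> \<phi> x" for a x
    by (simp add: \<phi>_def twisted_group_algebra_def)
  ultimately show ?thesis
    unfolding complex_algebra_iso_def ring_iso_def by blast
qed

text \<open>Both cocycles are compared with \<open>\<gamma>\<close>. This passes from inflated
  representatives, for which isomorphisms are constructed, to the arbitrary ones in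
  \<open>sim_C\<close>.\<close>

lemma (in group) twisted_group_algebra_same_class:
  assumes "\<gamma> \<in> cocycles2 G"
    and "\<alpha> \<in> coboundaries2 G #>\<^bsub>Z2 G\<^esub> \<gamma>" "\<beta> \<in> coboundaries2 G #>\<^bsub>Z2 G\<^esub> \<gamma>"
  shows "complex_algebra_iso (twisted_group_algebra G \<alpha>) (twisted_group_algebra G \<beta>)"
proof -
  have "complex_algebra_iso (twisted_group_algebra G \<gamma>) (twisted_group_algebra G \<delta>)"
    if \<delta>: "\<delta> \<in> coboundaries2 G #>\<^bsub>Z2 G\<^esub> \<gamma>" for \<delta>
  proof -
    from \<delta> obtain c where "\<forall>g\<in>carrier G. c g \<noteq> 0" "\<delta> = (\<lambda>g h. \<gamma> g h * coboundary G c g h)"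
      by (auto simp: r_coset_def coboundaries2_eq mult.commute)
    then show ?thesis using twisted_group_algebra_cohomologous[of c \<gamma>] assms(1) by auto
  qed
  then show ?thesis
    using assms complex_algebra_iso_trans twisted_group_algebra_sym by blast
qed

lemma complex_root_exists:
  fixes c :: complex
  assumes "n > 0" "c \<noteq> 0"
  shows "\<exists>x. x ^ n = c"
  using card_nth_roots[OF assms(2,1)] assms(1) by (metis (mono_tags) Collect_empty_eq card.empty less_irrefl)

section \<open>Inflation of cocycles to a Heisenberg-type cover\<close>

text \<open>By the last assumption, in the extension of \<open>A\<close> given by \<open>\<omega>\<close> every element is a product of
  two factors, for each of which the \<open>p\<close>-th roots of unity are commutators of elements commuting
  with that factor.\<close>

locale heisenberg_base = comm_group A for A :: "('c, 'n) monoid_scheme" (structure) +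
  fixes \<omega> :: "'c \<Rightarrow> 'c \<Rightarrow> complex" and p :: nat
  assumes omega: "\<omega> \<in> cocycles2 A"
    and omega_one: "\<omega> \<one> \<one> = 1"
    and p_pos: "p > 0"
    and commutators: "\<And>a. a \<in> carrier A \<Longrightarrow>
      \<exists>b\<in>carrier A. \<exists>c\<in>carrier A. a = b \<otimes> c \<and>
        (\<forall>d\<in>{b, c}. \<forall>w. w ^ p = 1 \<longrightarrow> (\<exists>u\<in>carrier A. \<exists>v\<in>carrier A.
          \<omega> d u = \<omega> u d \<and> \<omega> d v = \<omega> v d \<and> \<omega> u v = w * \<omega> v u))"

section \<open>Covers of the base and their central kernel\<close>

definition inflate ::
  "('a, 'm) monoid_scheme \<Rightarrow> ('a \<Rightarrow> 'c) \<Rightarrow> ('c \<Rightarrow> 'c \<Rightarrow> complex) \<Rightarrow> 'a \<Rightarrow> 'a \<Rightarrow> complex" where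
  "inflate G \<pi> \<eta> g h = (if g \<in> carrier G \<and> h \<in> carrier G then \<eta> (\<pi> g) (\<pi> h) else 1)"

text \<open>The assumptions say that \<open>g \<mapsto> (\<pi> g, z g)\<close> is a homomorphism
  into the extension of \<open>A\<close> given by \<open>\<omega>\<close>, onto \<open>A\<close> in
  the first coordinate, and that it identifies the kernel of \<open>\<pi>\<close> with the
  \<open>p\<close>-th roots of unity. The rule for \<open>z\<close> also says that the inflation of
  \<open>\<omega>\<close> is the coboundary of \<open>1 / z\<close>.\<close>

locale heisenberg_cover = heisenberg_base A \<omega> p + G: group G
  for A :: "('c, 'n) monoid_scheme" and \<omega> p and G :: "('a, 'm) monoid_scheme" (structure) +
  fixes \<pi> :: "'a \<Rightarrow> 'c" and z :: "'a \<Rightarrow> complex"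
  assumes fin_G: "finite (carrier G)"
    and pi_hom: "\<pi> \<in> hom G A"
    and pi_surj: "\<pi> ` carrier G = carrier A"
    and z_nonzero: "\<And>g. g \<in> carrier G \<Longrightarrow> z g \<noteq> 0"
    and z_mult: "\<And>g h. \<lbrakk>g \<in> carrier G; h \<in> carrier G\<rbrakk> \<Longrightarrow> z (g \<otimes> h) = z g * z h * \<omega> (\<pi> g) (\<pi> h)"
    and z_kernel: "bij_betw z (kernel G A \<pi>) {w. w ^ p = 1}"
begin

sublocale pi: group_hom G A \<pi>
  by unfold_locales (rule pi_hom)

lemma omega_one_left: "a \<in> carrier A \<Longrightarrow> \<omega> \<one>\<^bsub>A\<^esub> a = 1"
  using cocycles2_one_left[OF omega] omega_one by metis

lemma omega_one_right: "a \<in> carrier A \<Longrightarrow> \<omega> a \<one>\<^bsub>A\<^esub> = 1"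
  using cocycles2_one_right[OF omega] omega_one by metis

abbreviation N where "N \<equiv> kernel G A \<pi>"

lemma N_iff: "n \<in> N \<longleftrightarrow> n \<in> carrier G \<and> \<pi> n = \<one>\<^bsub>A\<^esub>"
  by (simp add: kernel_def)

lemma z_mult_N: "\<lbrakk>g \<in> carrier G; n \<in> N\<rbrakk> \<Longrightarrow> z (g \<otimes> n) = z g * z n"
  by (simp add: N_iff z_mult omega_one_right)

lemma z_one: "z \<one> = 1"
  using z_mult_N[of \<one> \<one>] z_nonzero[of \<one>] by (simp add: N_iff)

lemma z_root: "n \<in> N \<Longrightarrow> z n ^ p = 1"
  using z_kernel by (auto simp: bij_betw_def)

text \<open>The element \<open>inv g \<otimes> h\<close> lies in the kernel and has
  \<open>z\<close>-value 1, so it is trivial. Thus the map to the extension is injective, and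
  identities in \<open>G\<close> can be checked in coordinates.\<close>

lemma cover_eqI:
  assumes "g \<in> carrier G" "h \<in> carrier G" "\<pi> g = \<pi> h" "z g = z h"
  shows "g = h"
proof -
  let ?n = "inv g \<otimes> h"
  have n: "?n \<in> N" and h: "h = g \<otimes> ?n"
    using assms by (auto simp: N_iff G.m_assoc[symmetric])
  have "z ?n = 1"
    using z_mult_N[OF assms(1) n] h assms z_nonzero by auto
  moreover have "\<one> \<in> N" by (simp add: N_iff)
  ultimately have "?n = \<one>"
    using z_kernel n z_one by (auto simp: bij_betw_def inj_on_def)
  then show ?thesis using h assms by simp
qed

lemma commute_if:
  assumes "g \<in> carrier G" "h \<in> carrier G" "\<omega> (\<pi> g) (\<pi> h) = \<omega> (\<pi> h) (\<pi> g)"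
  shows "g \<otimes> h = h \<otimes> g"
  by (rule cover_eqI) (use assms in \<open>auto simp: z_mult m_comm\<close>)

lemma N_central: "\<lbrakk>g \<in> carrier G; n \<in> N\<rbrakk> \<Longrightarrow> n \<otimes> g = g \<otimes> n"
  by (rule commute_if) (auto simp: N_iff omega_one_left omega_one_right)

lemma N_closed: "\<lbrakk>n \<in> N; m \<in> N\<rbrakk> \<Longrightarrow> n \<otimes> m \<in> N"
  by (auto simp: N_iff)

section \<open>Cocycles of a cover on the kernel\<close>

lemma obtain_lift:
  assumes "a \<in> carrier A"
  obtains g where "g \<in> carrier G" "\<pi> g = a"
  using assms pi_surj by (metis imageE)

text \<open>If \<open>t\<close> lies over one of the two factors of \<open>\<pi> g\<close>, then
  \<open>n\<close> is a commutator of elements commuting with \<open>t\<close>, and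
  \<open>cocycle_commute\<close> applies to \<open>t\<close>. The cocycle identity carries the
  result over to the product of two such elements.\<close>

lemma cocycle_kernel_commute:
  assumes \<alpha>: "\<alpha> \<in> cocycles2 G" and g: "g \<in> carrier G" and n: "n \<in> N"
  shows "\<alpha> g n = \<alpha> n g"
proof -
  obtain b c where bc: "b \<in> carrier A" "c \<in> carrier A" "\<pi> g = b \<otimes>\<^bsub>A\<^esub> c"
    and comm: "\<And>d w. \<lbrakk>d \<in> {b, c}; w ^ p = 1\<rbrakk> \<Longrightarrow> \<exists>u\<in>carrier A. \<exists>v\<in>carrier A.
          \<omega> d u = \<omega> u d \<and> \<omega> d v = \<omega> v d \<and> \<omega> u v = w * \<omega> v u"
    using commutators[of "\<pi> g"] g by (metis pi.hom_closed)
  obtain x where x: "x \<in> carrier G" "\<pi> x = b" using bc by (rule_tac obtain_lift)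
  define y where "y = inv x \<otimes> g"
  have y: "y \<in> carrier G" "\<pi> y = c" "g = x \<otimes> y"
    using x g bc by (auto simp: y_def G.m_assoc[symmetric] m_assoc[symmetric])
  have n': "n \<in> carrier G" "\<pi> n = \<one>\<^bsub>A\<^esub>" using n by (auto simp: N_iff)
  have key: "\<alpha> t n = \<alpha> n t" if t: "t \<in> carrier G" "\<pi> t \<in> {b, c}" for t
  proof -
    obtain u v where uv: "u \<in> carrier A" "v \<in> carrier A" "\<omega> (\<pi> t) u = \<omega> u (\<pi> t)"
      "\<omega> (\<pi> t) v = \<omega> v (\<pi> t)" "\<omega> u v = z n * \<omega> v u"
      using comm[OF t(2) z_root[OF n]] by blast
    obtain u' where u': "u' \<in> carrier G" "\<pi> u' = u" using uv by (rule_tac obtain_lift)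
    obtain v' where v': "v' \<in> carrier G" "\<pi> v' = v" using uv by (rule_tac obtain_lift)
    \<comment> \<open>The \<open>z\<close>-values agree because \<open>u\<close> and
      \<open>v\<close> were chosen with \<open>\<omega> u v = z n * \<omega> v u\<close>.\<close>
    have "u' \<otimes> v' = n \<otimes> (v' \<otimes> u')"
      by (rule cover_eqI) (use u' v' n' uv in \<open>auto simp: z_mult m_comm omega_one_left\<close>)
    then show ?thesis
      using t u' v' n' uv by (intro G.cocycle_commute[OF \<alpha>, of t u' v' n] commute_if) auto
  qed
  note nz = cocycles2_nonzero[OF \<alpha>]
  \<comment> \<open>The chain moves \<open>n\<close> first past \<open>y\<close> and then past
    \<open>x\<close>, regrouping by the cocycle identity in between.\<close>
  have "\<alpha> x y * \<alpha> (x \<otimes> y) n = \<alpha> y n * \<alpha> x (y \<otimes> n)"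
    using cocycles2_eq[OF \<alpha>] x y n' by blast
  also have "\<dots> = \<alpha> n y * \<alpha> x (n \<otimes> y)"
    using key[of y] N_central[of y n] n y by simp
  also have "\<dots> = \<alpha> x n * \<alpha> (x \<otimes> n) y"
    using cocycles2_eq[OF \<alpha>, of x n y] x y n' by simp
  also have "\<dots> = \<alpha> n x * \<alpha> (n \<otimes> x) y"
    using key[of x] N_central[of x n] n x by simp
  also have "\<dots> = \<alpha> x y * \<alpha> n (x \<otimes> y)"
    using cocycles2_eq[OF \<alpha>, of n x y] x y n' by simp
  finally show ?thesis using nz y(3) by simp
qed

text \<open>Through \<open>z\<close> the kernel is the group of \<open>p\<close>-th roots of unity;
  \<open>t\<close> is the preimage of the standard primitive root. The third property records that
  its order is not smaller than \<open>p\<close>.\<close>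

lemma kernel_generator:
  obtains t where "t \<in> N" "\<And>n. n \<in> N \<Longrightarrow> \<exists>k::nat. t [^] k = n"
    "\<And>k l::nat. t [^] k = t [^] l \<Longrightarrow> k mod p = l mod p" "t [^] p = \<one>"
proof -
  define \<zeta> where "\<zeta> k = cis (2 * pi * real k / real p)" for k
  have bij: "bij_betw \<zeta> {..<p} {w. w ^ p = 1}"
    unfolding \<zeta>_def by (rule bij_betw_roots_unity[OF p_pos])
  have zeta_add: "\<zeta> (k + l) = \<zeta> k * \<zeta> l" for k l
    by (simp add: \<zeta>_def cis_mult add_divide_distrib distrib_left)
  have zeta_p: "\<zeta> (p * k) = 1" for k
    using p_pos by (simp add: \<zeta>_def) (metis cis_multiple_2pi Ints_of_nat mult.assoc)
  have zeta_mod: "\<zeta> (k mod p) = \<zeta> k" for k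
    using zeta_add[of "p * (k div p)" "k mod p"] zeta_p by simp
  have "\<zeta> 1 ^ p = 1"
    using zeta_p[of 1] p_pos by (simp add: \<zeta>_def DeMoivre)
  then obtain t where t: "t \<in> N" "z t = \<zeta> 1"
    using z_kernel by (metis (mono_tags, lifting) bij_betw_def imageE mem_Collect_eq)
  then have tG: "t \<in> carrier G" by (simp add: N_iff)
  have t_pow: "t [^] k \<in> N \<and> z (t [^] k) = \<zeta> k" for k :: nat
  proof (induction k)
    case 0
    then show ?case by (simp add: z_one \<zeta>_def N_iff)
  next
    case (Suc k)
    then show ?case using t zeta_add[of k 1] by (simp add: N_closed z_mult_N N_iff[of "t [^] k"])
  qed
  show thesis
  proof
    show "\<exists>k::nat. t [^] k = n" if n: "n \<in> N" for n
    proof -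
      obtain k where "\<zeta> k = z n"
        using z_root[OF n] bij by (metis (mono_tags, lifting) bij_betw_def imageE mem_Collect_eq)
      then have "t [^] k = n"
        using t_pow[of k] n by (intro cover_eqI) (auto simp: N_iff)
      then show ?thesis by blast
    qed
    show "k mod p = l mod p" if "t [^] k = t [^] l" for k l :: nat
    proof -
      have "\<zeta> (k mod p) = \<zeta> (l mod p)"
        using t_pow that by (metis zeta_mod)
      then show ?thesis
        using bij p_pos by (auto simp: bij_betw_def inj_on_def)
    qed
    show "t [^] p = \<one>"
      using t_pow[of p] zeta_p[of 1] by (intro cover_eqI) (auto simp: N_iff z_one)
  qed (rule t)
qed

text \<open>A lift of a generator of the cyclic group \<open>N\<close> to the extension is rescaled to have
  order \<open>p\<close>; its powers then split the extension over \<open>N\<close>.\<close>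

lemma kernel_cocycle_trivial:
  assumes \<alpha>: "\<alpha> \<in> cocycles2 G"
  obtains c where "\<And>n. n \<in> N \<Longrightarrow> c n \<noteq> 0"
    and "\<And>n m. \<lbrakk>n \<in> N; m \<in> N\<rbrakk> \<Longrightarrow> c (n \<otimes> m) = c n * c m * \<alpha> n m"
proof -
  let ?E = "cocycle_extension G \<alpha>"
  interpret E: group ?E by (rule G.group_cocycle_extension[OF \<alpha>])
  note nz = cocycles2_nonzero[OF \<alpha>]
  obtain t where t: "t \<in> N" "\<And>n. n \<in> N \<Longrightarrow> \<exists>k::nat. t [^] k = n"
    and t_inj: "\<And>k l::nat. t [^] k = t [^] l \<Longrightarrow> k mod p = l mod p" and t_p: "t [^] p = \<one>"
    using kernel_generator by blast
  then have tG: "t \<in> carrier G" by (simp add: N_iff)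
  \<comment> \<open>A discrete logarithm to the base \<open>t\<close>. It is additive only modulo
    \<open>p\<close>, so the lift of \<open>t\<close> must be chosen with trivial
    \<open>p\<close>-th power.\<close>
  obtain \<kappa> :: "'a \<Rightarrow> nat" where kappa: "\<And>n. n \<in> N \<Longrightarrow> t [^] \<kappa> n = n"
    using t(2) by metis
  have kappa_mult: "\<kappa> (n \<otimes> m) mod p = (\<kappa> n + \<kappa> m) mod p" if "n \<in> N" "m \<in> N" for n m
    using that tG by (intro t_inj) (simp add: G.nat_pow_mult[symmetric] kappa N_closed)
  define y where "y k = snd ((t, 1) [^]\<^bsub>?E\<^esub> k)" for k :: nat
  have y: "(t, x) [^]\<^bsub>?E\<^esub> k = (t [^] k, x ^ k * y k)" for x and k :: nat
  proof (induction k arbitrary: x)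
    case 0
    then show ?case by (simp add: y_def)
  next
    case (Suc k)
    have "y (Suc k) = y k * \<alpha> (t [^] k) t"
      unfolding y_def[of "Suc k"] by (simp add: Suc.IH[of 1])
    then show ?case by (simp add: Suc.IH[of x] mult_ac)
  qed
  have y_nz: "y k \<noteq> 0" for k
    using E.nat_pow_closed[of "(t, 1)" k] tG by (simp add: y)
  \<comment> \<open>The \<open>p\<close>-th power of \<open>(t, x)\<close> is
    \<open>(\<one>, x ^ p * y p)\<close>; for the identity its scalar has to be
    \<open>1 / \<alpha> \<one> \<one>\<close>, which fixes \<open>x ^ p\<close>.\<close>
  have "1 / (\<alpha> \<one> \<one> * y p) \<noteq> 0" using nz y_nz by simp
  then obtain x where x: "x ^ p = 1 / (\<alpha> \<one> \<one> * y p)"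
    using complex_root_exists[OF p_pos] by blast
  then have x_nz: "x \<noteq> 0"
    using nz y_nz p_pos by (auto simp: power_0_left)
  let ?b = "(t, x)"
  have b: "?b \<in> carrier ?E" using tG x_nz by simp
  have b_p: "?b [^]\<^bsub>?E\<^esub> p = \<one>\<^bsub>?E\<^esub>"
    using y_nz[of p] nz by (simp add: y t_p x)
  have b_mod: "?b [^]\<^bsub>?E\<^esub> (k mod p) = ?b [^]\<^bsub>?E\<^esub> k" for k
  proof -
    have "?b [^]\<^bsub>?E\<^esub> k = ?b [^]\<^bsub>?E\<^esub> (p * (k div p) + k mod p)" by simp
    also have "\<dots> = (?b [^]\<^bsub>?E\<^esub> p) [^]\<^bsub>?E\<^esub> (k div p) \<otimes>\<^bsub>?E\<^esub> ?b [^]\<^bsub>?E\<^esub> (k mod p)"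
      using b by (simp only: E.nat_pow_mult E.nat_pow_pow)
    finally show ?thesis using b by (simp only: b_p E.nat_pow_one E.l_one E.nat_pow_closed)
  qed
  define c where "c n = snd (?b [^]\<^bsub>?E\<^esub> \<kappa> n)" for n
  have c: "?b [^]\<^bsub>?E\<^esub> \<kappa> n = (n, c n)" if "n \<in> N" for n
    using kappa[OF that] by (simp add: c_def y)
  show thesis
  proof
    show "c n \<noteq> 0" if "n \<in> N" for n
      using E.nat_pow_closed[OF b, of "\<kappa> n"] that by (simp add: c)
    show "c (n \<otimes> m) = c n * c m * \<alpha> n m" if "n \<in> N" "m \<in> N" for n m
    proof -
      have "(n \<otimes> m, c (n \<otimes> m)) = ?b [^]\<^bsub>?E\<^esub> (\<kappa> n + \<kappa> m)"
        using that kappa_mult[OF that] b_mod[of "\<kappa> (n \<otimes> m)"] b_mod[of "\<kappa> n + \<kappa> m"]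
        by (metis c N_closed)
      also have "\<dots> = (n, c n) \<otimes>\<^bsub>?E\<^esub> (m, c m)"
        using b that by (simp only: c[symmetric] E.nat_pow_mult)
      finally show ?thesis by simp
    qed
  qed
qed

text \<open>The splitting \<open>c\<close> over the kernel is extended to all of \<open>G\<close> by
  means of a section of \<open>\<pi>\<close>. After correction by the resulting \<open>f\<close>,
  the cocycle is constant on cosets of the kernel in both arguments, so it comes from
  \<open>A\<close>.\<close>

lemma cocycle_inflated:
  assumes \<alpha>: "\<alpha> \<in> cocycles2 G"
  obtains \<eta> f where "\<eta> \<in> cocycles2 A" "\<And>g. g \<in> carrier G \<Longrightarrow> f g \<noteq> 0"
    "inflate G \<pi> \<eta> = (\<lambda>g h. \<alpha> g h * coboundary G f g h)"
proof -
  note nz = cocycles2_nonzero[OF \<alpha>]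
  obtain c where c: "\<And>n. n \<in> N \<Longrightarrow> c n \<noteq> 0"
    "\<And>n m. \<lbrakk>n \<in> N; m \<in> N\<rbrakk> \<Longrightarrow> c (n \<otimes> m) = c n * c m * \<alpha> n m"
    by (rule kernel_cocycle_trivial[OF \<alpha>]) (rule that)
  define s where "s = inv_into (carrier G) \<pi>"
  have s: "s a \<in> carrier G" "\<pi> (s a) = a" if "a \<in> carrier A" for a
    using that pi_surj unfolding s_def by (auto intro: inv_into_into f_inv_into_f)
  define \<nu> where "\<nu> g = inv (s (\<pi> g)) \<otimes> g" for g
  have nu: "\<nu> g \<in> N" "s (\<pi> g) \<otimes> \<nu> g = g" if "g \<in> carrier G" for g
    using that s[of "\<pi> g"] by (auto simp: \<nu>_def N_iff G.m_assoc[symmetric])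
  \<comment> \<open>In the extension, \<open>(g, f g)\<close> is the product of
    \<open>(s (\<pi> g), 1)\<close> and \<open>(\<nu> g, c (\<nu> g))\<close>. The next fact then
    says that multiplying \<open>(g, f g)\<close> by \<open>(m, c m)\<close> gives
    \<open>(g \<otimes> m, f (g \<otimes> m))\<close>.\<close>
  define f where "f g = c (\<nu> g) * \<alpha> (s (\<pi> g)) (\<nu> g)" for g
  have f_nz: "f g \<noteq> 0" if "g \<in> carrier G" for g
    using nu[OF that] c nz by (simp add: f_def)
  have f_mult: "f (g \<otimes> m) = f g * c m * \<alpha> g m" if g: "g \<in> carrier G" and m: "m \<in> N" for g m
  proof -
    have m': "m \<in> carrier G" "\<pi> m = \<one>\<^bsub>A\<^esub>" using m by (auto simp: N_iff)
    have pi: "\<pi> (g \<otimes> m) = \<pi> g" using g m' by simp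
    have nu_m: "\<nu> (g \<otimes> m) = \<nu> g \<otimes> m"
      using g m' s[of "\<pi> g"] by (simp add: \<nu>_def G.m_assoc)
    have nuG: "\<nu> g \<in> carrier G" using nu[OF g] by (simp add: N_iff)
    show ?thesis
      using cocycles2_eq[OF \<alpha>, of "s (\<pi> g)" "\<nu> g" m] g m' s[of "\<pi> g"] nu[OF g] c(2)[OF nu(1)[OF g] m] nuG
      by (simp add: f_def pi nu_m mult_ac)
  qed
  define \<beta> where "\<beta> = (\<lambda>g h. \<alpha> g h * coboundary G f g h)"
  have \<beta>: "\<beta> \<in> cocycles2 G"
    unfolding \<beta>_def by (rule cocycles2_mult[OF \<alpha> G.coboundary_in_cocycles2]) (rule f_nz)
  have left: "\<beta> (g \<otimes> m) h = \<beta> g h" and right: "\<beta> g (h \<otimes> m) = \<beta> g h"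
    if g: "g \<in> carrier G" and h: "h \<in> carrier G" and m: "m \<in> N" for g h m
  proof -
    have m': "m \<in> carrier G" using m by (auto simp: N_iff)
    have gh: "g \<otimes> h \<in> carrier G" using g h by simp
    have mh: "m \<otimes> h = h \<otimes> m" by (rule N_central[OF h m])
    have ghm: "g \<otimes> m \<otimes> h = g \<otimes> h \<otimes> m" "g \<otimes> (h \<otimes> m) = g \<otimes> h \<otimes> m"
      using g h m' mh by (auto simp: G.m_assoc)
    \<comment> \<open>Invariance in the first argument is where centrality of the lifted kernel
      enters: \<open>\<alpha> m h\<close> is exchanged for \<open>\<alpha> h m\<close>. Invariance
      in the second follows from the cocycle identity and \<open>f_mult\<close>.\<close>
    have e1: "\<alpha> g m * \<alpha> (g \<otimes> m) h = \<alpha> g h * \<alpha> (g \<otimes> h) m"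
      using cocycles2_eq[OF \<alpha> g m' h] cocycles2_eq[OF \<alpha> g h m'] mh
        cocycle_kernel_commute[OF \<alpha> h m] by simp
    have e2: "\<alpha> h m * \<alpha> g (h \<otimes> m) = \<alpha> g h * \<alpha> (g \<otimes> h) m"
      using cocycles2_eq[OF \<alpha> g h m'] by simp
    have "\<beta> (g \<otimes> m) h = (\<alpha> g m * \<alpha> (g \<otimes> m) h) * (f g * c m * f h / f (g \<otimes> m \<otimes> h))"
      using g h m' by (simp add: \<beta>_def coboundary_def f_mult[OF g m])
    then show "\<beta> (g \<otimes> m) h = \<beta> g h"
      unfolding e1 ghm f_mult[OF gh m] using g h f_nz[OF gh] c(1)[OF m] nz
      by (simp add: \<beta>_def coboundary_def)
    have "\<beta> g (h \<otimes> m) = (\<alpha> h m * \<alpha> g (h \<otimes> m)) * (f g * f h * c m / f (g \<otimes> (h \<otimes> m)))"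
      using g h m' by (simp add: \<beta>_def coboundary_def f_mult[OF h m])
    then show "\<beta> g (h \<otimes> m) = \<beta> g h"
      unfolding e2 ghm f_mult[OF gh m] using g h f_nz[OF gh] c(1)[OF m] nz
      by (simp add: \<beta>_def coboundary_def)
  qed
  have sect: "\<beta> g h = \<beta> (s (\<pi> g)) (s (\<pi> h))" if g: "g \<in> carrier G" and h: "h \<in> carrier G" for g h
    using left[OF _ h nu(1)[OF g], of "s (\<pi> g)"] right[OF _ _ nu(1)[OF h], of "s (\<pi> g)" "s (\<pi> h)"]
      nu(2)[OF g] nu(2)[OF h] s[of "\<pi> g"] s[of "\<pi> h"] g h by simp
  define \<eta> where "\<eta> a b = (if a \<in> carrier A \<and> b \<in> carrier A then \<beta> (s a) (s b) else 1)" for a b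
  have eta: "\<eta> (\<pi> g) (\<pi> h) = \<beta> g h" if "g \<in> carrier G" "h \<in> carrier G" for g h
    using that sect by (simp add: \<eta>_def)
  have "\<eta> \<in> cocycles2 A"
  proof -
    have "\<eta> a b * \<eta> (a \<otimes>\<^bsub>A\<^esub> b) d = \<eta> b d * \<eta> a (b \<otimes>\<^bsub>A\<^esub> d)"
      if "a \<in> carrier A" "b \<in> carrier A" "d \<in> carrier A" for a b d
    proof -
      obtain g h k where "g \<in> carrier G" "\<pi> g = a" "h \<in> carrier G" "\<pi> h = b" "k \<in> carrier G" "\<pi> k = d"
        using \<open>a \<in> carrier A\<close> \<open>b \<in> carrier A\<close> \<open>d \<in> carrier A\<close> s by metis
      then show ?thesis
        using cocycles2_eq[OF \<beta>, of g h k] eta[of g h] eta[of "g \<otimes> h" k] eta[of h k] eta[of g "h \<otimes> k"]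
        by simp
    qed
    then show ?thesis
      using cocycles2_nonzero[OF \<beta>] by (auto simp: cocycles2_def \<eta>_def)
  qed
  moreover have "inflate G \<pi> \<eta> = \<beta>"
    using eta cocycles2_outside[OF \<beta>] by (auto simp: inflate_def fun_eq_iff)
  ultimately show thesis using that f_nz unfolding \<beta>_def by blast
qed

end

section \<open>The second cohomology group of a cover\<close>

text \<open>Both targets are the quotient of \<open>\<Gamma>\<close> by the common kernel.
  Compatibility of \<open>\<psi>\<close> with the two projections is recorded because it later
  matches the class of an inflated cocycle on one cover with the class on the other.\<close>

lemma hom_iso_same_kernel:
  assumes "group_hom \<Gamma> G h" "group_hom \<Gamma> H k"
    and surj: "h ` carrier \<Gamma> = carrier G" "k ` carrier \<Gamma> = carrier H"
    and ker: "kernel \<Gamma> G h = kernel \<Gamma> H k"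
  shows "\<exists>\<psi>\<in>iso G H. \<forall>x\<in>carrier \<Gamma>. \<psi> (h x) = k x"
proof -
  interpret h: group_hom \<Gamma> G h by fact
  interpret k: group_hom \<Gamma> H k by fact
  have eq: "h x = h y \<longleftrightarrow> k x = k y" if xy: "x \<in> carrier \<Gamma>" "y \<in> carrier \<Gamma>" for x y
  proof -
    have "h x = h y \<longleftrightarrow> x \<otimes>\<^bsub>\<Gamma>\<^esub> inv\<^bsub>\<Gamma>\<^esub> y \<in> kernel \<Gamma> G h"
      using xy h.H.inv_solve_right'[of "\<one>\<^bsub>G\<^esub>" "h x" "h y"] by (auto simp: kernel_def)
    moreover have "k x = k y \<longleftrightarrow> x \<otimes>\<^bsub>\<Gamma>\<^esub> inv\<^bsub>\<Gamma>\<^esub> y \<in> kernel \<Gamma> H k"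
      using xy k.H.inv_solve_right'[of "\<one>\<^bsub>H\<^esub>" "k x" "k y"] by (auto simp: kernel_def)
    ultimately show ?thesis using ker by simp
  qed
  define \<psi> where "\<psi> y = k (inv_into (carrier \<Gamma>) h y)" for y
  have psi: "\<psi> (h x) = k x" if "x \<in> carrier \<Gamma>" for x
    using that eq[of "inv_into (carrier \<Gamma>) h (h x)" x] inv_into_into[of "h x" h "carrier \<Gamma>"]
      f_inv_into_f[of "h x" h "carrier \<Gamma>"] by (auto simp: \<psi>_def)
  have "\<psi> \<in> hom G H"
    by (rule homI) (auto simp: surj[symmetric] psi simp flip: h.hom_mult k.hom_mult)
  moreover have "bij_betw \<psi> (carrier G) (carrier H)"
    unfolding bij_betw_def inj_on_def
    by (auto simp: surj[symmetric] psi eq image_iff)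
  ultimately show ?thesis using psi unfolding iso_def by blast
qed

context heisenberg_cover
begin

lemma inflate_cocycle:
  assumes "\<eta> \<in> cocycles2 A"
  shows "inflate G \<pi> \<eta> \<in> cocycles2 G"
  using assms unfolding cocycles2_def by (auto simp: inflate_def)

lemma coboundaries2_iff:
  "\<alpha> \<in> coboundaries2 G \<longleftrightarrow> (\<exists>c. (\<forall>g\<in>carrier G. c g \<noteq> 0) \<and> \<alpha> = coboundary G c)"
  by (auto simp: G.coboundaries2_eq)

text \<open>The kernel is cyclic of order \<open>p\<close>, so a character is determined by its
  value on a generator \<open>t\<close>. That value is a \<open>p\<close>-th root of unity and hence
  a power of \<open>z t\<close>.\<close>

lemma kernel_character:
  assumes nz: "\<And>n. n \<in> N \<Longrightarrow> \<chi> n \<noteq> 0"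
    and mult: "\<And>n m. \<lbrakk>n \<in> N; m \<in> N\<rbrakk> \<Longrightarrow> \<chi> (n \<otimes> m) = \<chi> n * (\<chi> m :: complex)"
  obtains j where "\<And>n. n \<in> N \<Longrightarrow> \<chi> n = z n ^ j"
proof -
  obtain t where t: "t \<in> N" "\<And>n. n \<in> N \<Longrightarrow> \<exists>k::nat. t [^] k = n" "t [^] p = \<one>"
    using kernel_generator by metis
  have one: "\<one> \<in> N" by (simp add: N_iff)
  have chi_one: "\<chi> \<one> = 1" using mult[OF one one] nz[OF one] by simp
  have pow: "t [^] k \<in> N \<and> \<chi> (t [^] k) = \<chi> t ^ k \<and> z (t [^] k) = z t ^ k" for k :: nat
  proof (induction k)
    case 0
    then show ?case by (simp add: one chi_one z_one)
  next
    case (Suc k)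
    then show ?case using t(1) mult[of "t [^] k" t]
      by (simp add: N_closed z_mult_N N_iff[of "t [^] k"] mult.commute)
  qed
  have "\<chi> t ^ p = 1" using pow[of p] t(3) chi_one by simp
  then obtain m where "m \<in> N" "z m = \<chi> t"
    using z_kernel by (metis (mono_tags, lifting) bij_betw_def imageE mem_Collect_eq)
  then obtain j :: nat where j: "\<chi> t = z t ^ j" using t(2) pow by metis
  have "\<chi> n = z n ^ j" if "n \<in> N" for n
    using t(2)[OF that] pow j by (metis power_mult mult.commute)
  then show thesis by (rule that)
qed

text \<open>The right-hand side says that \<open>\<eta>\<close> is cohomologous to a power of
  \<open>\<omega>\<close>. If the inflation is the coboundary of \<open>f\<close>, then
  \<open>f\<close> restricts on the kernel, up to a constant, to a character \<open>z ^ j\<close>,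
  and \<open>f / z ^ j\<close> descends to \<open>A\<close>.\<close>

lemma inflate_coboundary_iff:
  assumes \<eta>: "\<eta> \<in> cocycles2 A"
  shows "inflate G \<pi> \<eta> \<in> coboundaries2 G \<longleftrightarrow>
    (\<exists>j c. (\<forall>a\<in>carrier A. c a \<noteq> 0) \<and>
      (\<forall>a\<in>carrier A. \<forall>b\<in>carrier A. \<eta> a b * \<omega> a b ^ j = c a * c b / c (a \<otimes>\<^bsub>A\<^esub> b)))"
    (is "?L \<longleftrightarrow> ?R")
proof
  assume ?R
  then obtain j c where c: "\<And>a. a \<in> carrier A \<Longrightarrow> c a \<noteq> 0"
    "\<And>a b. \<lbrakk>a \<in> carrier A; b \<in> carrier A\<rbrakk> \<Longrightarrow> \<eta> a b * \<omega> a b ^ j = c a * c b / c (a \<otimes>\<^bsub>A\<^esub> b)"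
    by blast
  \<comment> \<open>The factor \<open>z g ^ j\<close> accounts for the power of
    \<open>\<omega>\<close>, whose inflation is the coboundary of \<open>1 / z ^ j\<close>.\<close>
  have "inflate G \<pi> \<eta> = coboundary G (\<lambda>g. c (\<pi> g) * z g ^ j)"
  proof (intro ext)
    fix g h
    show "inflate G \<pi> \<eta> g h = coboundary G (\<lambda>g. c (\<pi> g) * z g ^ j) g h"
      using c(1)[of "\<pi> g"] c(1)[of "\<pi> h"] c(1)[of "\<pi> g \<otimes>\<^bsub>A\<^esub> \<pi> h"] c(2)[of "\<pi> g" "\<pi> h"] z_nonzero[of g] z_nonzero[of h]
        cocycles2_nonzero[OF omega, of "\<pi> g" "\<pi> h"]
      by (auto simp: inflate_def coboundary_def z_mult power_mult_distrib field_simps)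
  qed
  then show ?L unfolding coboundaries2_iff using c z_nonzero
    by (intro exI[of _ "\<lambda>g. c (\<pi> g) * z g ^ j"]) auto
next
  assume ?L
  then obtain f where f: "\<And>g. g \<in> carrier G \<Longrightarrow> f g \<noteq> 0" "inflate G \<pi> \<eta> = coboundary G f"
    unfolding coboundaries2_iff by blast
  \<comment> \<open>Since \<open>\<eta>\<close> is not normalised, \<open>f\<close> is
    multiplicative on the kernel only after division by this constant.\<close>
  define e where "e = \<eta> \<one>\<^bsub>A\<^esub> \<one>\<^bsub>A\<^esub>"
  have e_nz: "e \<noteq> 0" using cocycles2_nonzero[OF \<eta>] by (simp add: e_def)
  have f_mult: "f (g \<otimes> h) * \<eta> (\<pi> g) (\<pi> h) = f g * f h" if "g \<in> carrier G" "h \<in> carrier G" for g h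
    using fun_cong[OF fun_cong[OF f(2)], of g h] that f(1)[of "g \<otimes> h"]
    by (simp add: inflate_def coboundary_def field_simps)
  have f_N: "f (g \<otimes> n) * e = f g * f n" if "g \<in> carrier G" "n \<in> N" for g n
    using f_mult[of g n] that cocycles2_one_right[OF \<eta>, of "\<pi> g"] by (simp add: N_iff e_def)
  obtain j where j: "\<And>n. n \<in> N \<Longrightarrow> f n / e = z n ^ j"
  proof (rule kernel_character[of "\<lambda>n. f n / e"])
    show "f n / e \<noteq> 0" if "n \<in> N" for n using that f(1) e_nz by (simp add: N_iff)
    show "f (n \<otimes> m) / e = f n / e * (f m / e)" if "n \<in> N" "m \<in> N" for n m
      using f_N[of n m] that e_nz by (simp add: N_iff field_simps)
  qed (rule that)
  define F where "F g = f g / z g ^ j" for g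
  have F_N: "F (g \<otimes> n) = F g" if "g \<in> carrier G" "n \<in> N" for g n
  proof -
    have "f (g \<otimes> n) = f g * z n ^ j"
      using f_N[OF that] j[OF that(2)] e_nz by (simp add: field_simps)
    then show ?thesis
      using that z_nonzero[of n] by (simp add: F_def z_mult_N power_mult_distrib N_iff)
  qed
  \<comment> \<open>As \<open>F\<close> is constant on the fibres of \<open>\<pi>\<close>,
    evaluating it along any section yields the required function on \<open>A\<close>.\<close>
  define s where "s = inv_into (carrier G) \<pi>"
  have s: "s a \<in> carrier G" "\<pi> (s a) = a" if "a \<in> carrier A" for a
    using that pi_surj unfolding s_def by (auto intro: inv_into_into f_inv_into_f)
  have F_s: "F g = F (s (\<pi> g))" if "g \<in> carrier G" for g
    using F_N[of "s (\<pi> g)" "inv (s (\<pi> g)) \<otimes> g"] s[of "\<pi> g"] that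
    by (simp add: N_iff G.m_assoc[symmetric])
  have "\<eta> a b * \<omega> a b ^ j = F (s a) * F (s b) / F (s (a \<otimes>\<^bsub>A\<^esub> b))"
    if ab: "a \<in> carrier A" "b \<in> carrier A" for a b
  proof -
    have "F (s (a \<otimes>\<^bsub>A\<^esub> b)) = F (s a \<otimes> s b)"
      using F_s[of "s a \<otimes> s b"] ab s by simp
    moreover have "\<eta> a b = f (s a) * f (s b) / f (s a \<otimes> s b)"
      using f_mult[of "s a" "s b"] f(1)[of "s a \<otimes> s b"] ab s by (simp add: field_simps)
    ultimately show ?thesis
      using ab s z_nonzero[of "s a"] z_nonzero[of "s b"]
      by (simp add: F_def z_mult power_mult_distrib)
  qed
  moreover have "F (s a) \<noteq> 0" if "a \<in> carrier A" for a
    using s[OF that] f(1) z_nonzero by (simp add: F_def)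
  ultimately show ?R by (intro exI[of _ j] exI[of _ "\<lambda>a. F (s a)"]) simp
qed

section \<open>The map from cocycles of the base to classes of the cover\<close>

definition class_map :: "('c \<Rightarrow> 'c \<Rightarrow> complex) \<Rightarrow> ('a \<Rightarrow> 'a \<Rightarrow> complex) set" where
  "class_map \<eta> = coboundaries2 G #>\<^bsub>Z2 G\<^esub> inflate G \<pi> \<eta>"

lemma group_hom_class_map: "group_hom (Z2 A) (H2 G) class_map"
proof -
  have "inflate G \<pi> \<in> hom (Z2 A) (Z2 G)"
    by (rule homI) (auto simp: inflate_cocycle, auto simp: inflate_def fun_eq_iff)
  then have "(\<lambda>\<alpha>. coboundaries2 G #>\<^bsub>Z2 G\<^esub> \<alpha>) \<circ> inflate G \<pi> \<in> hom (Z2 A) (H2 G)"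
    unfolding H2_def by (rule Group.hom_compose[OF _ normal.r_coset_hom_Mod[OF G.coboundaries2_normal]])
  then have "class_map \<in> hom (Z2 A) (H2 G)"
    by (simp add: class_map_def[abs_def] comp_def)
  then show ?thesis
    by (simp add: group_hom_def group_hom_axioms_def comm_group.axioms(2)[OF comm_group_Z2] G.group_H2)
qed

text \<open>Surjectivity restates that every cocycle of the cover is cohomologous to an inflated
  one.\<close>

lemma class_map_surj: "class_map ` carrier (Z2 A) = carrier (H2 G)"
proof
  show "class_map ` carrier (Z2 A) \<subseteq> carrier (H2 G)"
    using group_hom.hom_closed[OF group_hom_class_map] by blast
  show "carrier (H2 G) \<subseteq> class_map ` carrier (Z2 A)"
  proof
    fix X assume "X \<in> carrier (H2 G)"
    then obtain \<alpha> where \<alpha>: "\<alpha> \<in> cocycles2 G" "X = coboundaries2 G #>\<^bsub>Z2 G\<^esub> \<alpha>"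
      by (auto simp: H2_def carrier_FactGroup)
    obtain \<eta> f where \<eta>: "\<eta> \<in> cocycles2 A" "\<And>g. g \<in> carrier G \<Longrightarrow> f g \<noteq> 0"
      "inflate G \<pi> \<eta> = (\<lambda>g h. \<alpha> g h * coboundary G f g h)"
      by (rule cocycle_inflated[OF \<alpha>(1)]) (rule that)
    have "inflate G \<pi> \<eta> = coboundary G f \<otimes>\<^bsub>Z2 G\<^esub> \<alpha>"
      using \<eta>(3) by (simp add: mult.commute)
    moreover have "coboundary G f \<in> coboundaries2 G" using \<eta>(2) coboundaries2_iff by blast
    ultimately have "inflate G \<pi> \<eta> \<in> coboundaries2 G #>\<^bsub>Z2 G\<^esub> \<alpha>"
      unfolding r_coset_def by blast
    then have "X = class_map \<eta>"
      unfolding class_map_def \<alpha>(2) using \<alpha>(1)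
      by (intro group.repr_independence[OF comm_group.axioms(2)[OF comm_group_Z2]])
        (auto simp: G.coboundaries2_subgroup)
    then show "X \<in> class_map ` carrier (Z2 A)" using \<eta>(1) by simp
  qed
qed

text \<open>The description mentions only \<open>A\<close> and \<open>\<omega>\<close>, so the
  kernel is the same for all covers of one base.\<close>

lemma class_map_kernel:
  "kernel (Z2 A) (H2 G) class_map = {\<eta> \<in> cocycles2 A. \<exists>j c. (\<forall>a\<in>carrier A. c a \<noteq> 0) \<and>
      (\<forall>a\<in>carrier A. \<forall>b\<in>carrier A. \<eta> a b * \<omega> a b ^ j = c a * c b / c (a \<otimes>\<^bsub>A\<^esub> b))}"
proof -
  have "class_map \<eta> = \<one>\<^bsub>H2 G\<^esub> \<longleftrightarrow> inflate G \<pi> \<eta> \<in> coboundaries2 G" if "\<eta> \<in> cocycles2 A" for \<eta>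
    unfolding class_map_def H2_def one_FactGroup
    using group.coset_join1[OF comm_group.axioms(2)[OF comm_group_Z2] _ _ G.coboundaries2_subgroup]
      group.coset_join2[OF comm_group.axioms(2)[OF comm_group_Z2] _ G.coboundaries2_subgroup]
      inflate_cocycle[OF that] by (metis carrier_Z2)
  then show ?thesis
    by (simp add: kernel_def inflate_coboundary_iff cong: conj_cong)
qed

end

section \<open>The twisted group algebras of a cover\<close>

text \<open>The direct sum, over \<open>j < p\<close>, of the twisted group algebras of
  \<open>A\<close> for \<open>\<eta>\<omega>^j\<close>; the index \<open>(a, j)\<close> is the basis
  vector of \<open>a\<close> in the summand \<open>j\<close>. The unit has the same coefficient in
  every summand, as \<open>\<omega>\<close> is 1 at the identity in a
  \<open>heisenberg_base\<close>.\<close>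

definition twisted_sum_algebra ::
  "('c, 'n) monoid_scheme \<Rightarrow> ('c \<Rightarrow> 'c \<Rightarrow> complex) \<Rightarrow> nat \<Rightarrow> ('c \<Rightarrow> 'c \<Rightarrow> complex)
    \<Rightarrow> (complex, 'c \<times> nat \<Rightarrow> complex) module" where
  "twisted_sum_algebra A \<omega> p \<eta> =
    \<lparr>carrier = {y. \<forall>a j. \<not> (a \<in> carrier A \<and> j < p) \<longrightarrow> y (a, j) = 0},
     mult = (\<lambda>x y (c, j). \<Sum>(a, b)\<in>{(a, b). a \<in> carrier A \<and> b \<in> carrier A \<and> a \<otimes>\<^bsub>A\<^esub> b = c}.
       x (a, j) * y (b, j) * (\<eta> a b * \<omega> a b ^ j)),
     one = (\<lambda>(a, j). if a = \<one>\<^bsub>A\<^esub> \<and> j < p then 1 / \<eta> \<one>\<^bsub>A\<^esub> \<one>\<^bsub>A\<^esub> else 0),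
     zero = (\<lambda>_. 0),
     add = (\<lambda>x y i. x i + y i),
     smult = (\<lambda>c x i. c * x i)\<rparr>"

section \<open>Orthogonality relations for roots of unity\<close>

lemma sum_root_of_unity_powers:
  fixes w :: complex
  assumes "w ^ p = 1"
  shows "(\<Sum>j<p. w ^ j) = (if w = 1 then of_nat p else 0)"
  using assms by (auto simp: geometric_sum)

text \<open>Multiplication by a primitive root \<open>v\<close> permutes the roots of unity and
  multiplies the sum by \<open>v ^ j / v ^ i\<close>. For \<open>i \<noteq> j\<close> this factor is
  not 1, so the sum vanishes.\<close>

lemma sum_over_roots_of_unity:
  assumes "i < p" "j < p"
  shows "(\<Sum>w | w ^ p = 1. w ^ j / w ^ i) = (if i = j then of_nat p else (0::complex))"
proof -
  let ?U = "{w::complex. w ^ p = 1}"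
  have p: "p > 0" using assms by simp
  have nz: "w \<noteq> 0" if "w \<in> ?U" for w using that p by (auto simp: power_0_left)
  have card: "card ?U = p" using card_roots_unity_eq[OF p] by simp
  show ?thesis
  proof (cases "i = j")
    case True
    then have "(\<Sum>w\<in>?U. w ^ j / w ^ i) = (\<Sum>w\<in>?U. 1)"
      using nz by (intro sum.cong) auto
    then show ?thesis using card True by simp
  next
    case False
    define v where "v = cis (2 * pi / real p)"
    have pow: "v ^ k = cis (2 * pi * real k / real p)" for k
      by (simp add: v_def DeMoivre mult_ac)
    have v: "v \<in> ?U" using pow[of p] p by simp
    have "v ^ i \<noteq> v ^ j"
      using bij_betw_roots_unity[OF p] False assms unfolding pow bij_betw_def inj_on_def by auto
    then have neq: "v ^ j / v ^ i \<noteq> 1" using nz[OF v] by simp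
    have bij: "bij_betw (\<lambda>w. v * w) ?U ?U"
      by (rule bij_betw_byWitness[where f' = "\<lambda>w. w / v"])
        (use v nz[OF v] in \<open>auto simp: power_mult_distrib power_divide\<close>)
    have "(\<Sum>w\<in>?U. w ^ j / w ^ i) = (\<Sum>w\<in>?U. (v * w) ^ j / (v * w) ^ i)"
      by (rule sum.reindex_bij_betw[OF bij, symmetric])
    also have "\<dots> = v ^ j / v ^ i * (\<Sum>w\<in>?U. w ^ j / w ^ i)"
      by (simp add: sum_distrib_left power_mult_distrib)
    finally have "(\<Sum>w\<in>?U. w ^ j / w ^ i) = 0 \<or> v ^ j / v ^ i = 1"
      unfolding mult_cancel_right1 .
    then show ?thesis using neq False by argo
  qed
qed

context heisenberg_cover
begin

section \<open>Fibres of the projection and the Fourier transform along them\<close>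

definition fiber :: "'c \<Rightarrow> 'a set" where
  "fiber a = {g \<in> carrier G. \<pi> g = a}"

lemma finite_fiber: "finite (fiber a)"
  using fin_G by (simp add: fiber_def)

lemma finite_A: "finite (carrier A)"
  using fin_G pi_surj finite_imageI by metis

lemma fiber_outside: "a \<notin> carrier A \<Longrightarrow> fiber a = {}"
  by (auto simp: fiber_def)

text \<open>A fibre is a coset of the kernel, and its representative contributes only a constant
  factor; this reduces the sum to the orthogonality of distinct characters of the kernel.\<close>

lemma sum_fiber:
  assumes "a \<in> carrier A" "i < p" "j < p"
  shows "(\<Sum>g\<in>fiber a. z g ^ j / z g ^ i) = (if i = j then of_nat p else 0)"
proof -
  obtain s where s: "s \<in> carrier G" "\<pi> s = a" using obtain_lift[OF assms(1)] .
  have "bij_betw (\<lambda>n. s \<otimes> n) N (fiber a)"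
    by (rule bij_betw_byWitness[where f' = "\<lambda>g. inv s \<otimes> g"])
      (use s in \<open>auto simp: fiber_def N_iff G.m_assoc[symmetric]\<close>)
  then have "(\<Sum>g\<in>fiber a. z g ^ j / z g ^ i) = (\<Sum>n\<in>N. z (s \<otimes> n) ^ j / z (s \<otimes> n) ^ i)"
    by (rule sum.reindex_bij_betw[symmetric])
  also have "\<dots> = z s ^ j / z s ^ i * (\<Sum>n\<in>N. z n ^ j / z n ^ i)"
    using s by (simp add: sum_distrib_left z_mult_N power_mult_distrib)
  also have "(\<Sum>n\<in>N. z n ^ j / z n ^ i) = (\<Sum>w | w ^ p = 1. w ^ j / w ^ i)"
    by (rule sum.reindex_bij_betw[OF z_kernel])
  finally show ?thesis
    using sum_over_roots_of_unity[OF assms(2,3)] z_nonzero[OF s(1)] by simp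
qed

text \<open>The dual orthogonality relation: \<open>z h / z g\<close> is a \<open>p\<close>-th root
  of unity, and it equals 1 only for \<open>h = g\<close>.\<close>

lemma sum_characters:
  assumes gh: "g \<in> carrier G" "h \<in> fiber (\<pi> g)"
  shows "(\<Sum>j<p. z h ^ j / z g ^ j) = (if h = g then of_nat p else 0)"
proof -
  let ?n = "inv g \<otimes> h"
  have h: "h \<in> carrier G" "\<pi> h = \<pi> g" using gh by (auto simp: fiber_def)
  have n: "?n \<in> N" and hn: "h = g \<otimes> ?n"
    using gh(1) h by (auto simp: N_iff G.m_assoc[symmetric])
  have zn: "z h / z g = z ?n"
    using z_mult_N[OF gh(1) n] hn z_nonzero[OF gh(1)] by simp
  have "(\<Sum>j<p. z h ^ j / z g ^ j) = (\<Sum>j<p. (z h / z g) ^ j)"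
    by (simp add: power_divide)
  also have "\<dots> = (if z h / z g = 1 then of_nat p else 0)"
    using z_root[OF n] zn by (intro sum_root_of_unity_powers) simp
  also have "z h / z g = 1 \<longleftrightarrow> h = g"
    using cover_eqI[OF h(1) gh(1) h(2)] z_nonzero[OF gh(1)] by auto
  finally show ?thesis .
qed

text \<open>The basis vector of \<open>g\<close> goes to \<open>z g ^ j\<close> times the basis
  vector of \<open>\<pi> g\<close> in the summand \<open>j\<close>. On the summands this separates
  the characters \<open>z ^ j\<close> of the kernel.\<close>

definition fourier :: "('a \<Rightarrow> complex) \<Rightarrow> 'c \<times> nat \<Rightarrow> complex" where
  "fourier x = (\<lambda>(a, j). if j < p then \<Sum>g\<in>fiber a. x g * z g ^ j else 0)"

lemma fourier_bij:
  "bij_betw fourier (carrier (twisted_group_algebra G \<alpha>)) (carrier (twisted_sum_algebra A \<omega> p \<eta>))"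
proof (rule bij_betw_byWitness)
  \<comment> \<open>Fourier inversion: the two orthogonality relations show that it inverts
    \<open>fourier\<close> on either side.\<close>
  let ?inv = "\<lambda>y g. if g \<in> carrier G then (\<Sum>j<p. y (\<pi> g, j) / z g ^ j) / of_nat p else 0"
  show "\<forall>x\<in>carrier (twisted_group_algebra G \<alpha>). ?inv (fourier x) = x"
  proof (intro ballI ext)
    fix x g assume x: "x \<in> carrier (twisted_group_algebra G \<alpha>)"
    show "?inv (fourier x) g = x g"
    proof (cases "g \<in> carrier G")
      case False
      then show ?thesis using x by (simp add: twisted_group_algebra_def)
    next
      case True
      have "(\<Sum>j<p. fourier x (\<pi> g, j) / z g ^ j) = (\<Sum>j<p. \<Sum>h\<in>fiber (\<pi> g). x h * (z h ^ j / z g ^ j))"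
        by (simp add: fourier_def sum_divide_distrib)
      also have "\<dots> = (\<Sum>h\<in>fiber (\<pi> g). x h * (\<Sum>j<p. z h ^ j / z g ^ j))"
        unfolding sum_distrib_left by (rule sum.swap)
      also have "\<dots> = (\<Sum>h\<in>fiber (\<pi> g). if h = g then x h * of_nat p else 0)"
        by (rule sum.cong) (auto simp: sum_characters[OF True])
      also have "\<dots> = x g * of_nat p"
        using True finite_fiber by (simp add: fiber_def)
      finally show ?thesis using True p_pos by simp
    qed
  qed
  show "\<forall>y\<in>carrier (twisted_sum_algebra A \<omega> p \<eta>). fourier (?inv y) = y"
  proof (intro ballI ext)
    fix y and i :: "'c \<times> nat" assume y: "y \<in> carrier (twisted_sum_algebra A \<omega> p \<eta>)"
    obtain a :: 'c and j :: nat where i: "i = (a, j)" by (cases i)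
    show "fourier (?inv y) i = y i"
    proof (cases "a \<in> carrier A \<and> j < p")
      case False
      then show ?thesis using y by (auto simp: i fourier_def fiber_outside twisted_sum_algebra_def)
    next
      case True
      have "(\<Sum>g\<in>fiber a. ?inv y g * z g ^ j)
          = (\<Sum>g\<in>fiber a. \<Sum>k<p. y (a, k) / of_nat p * (z g ^ j / z g ^ k))"
        by (rule sum.cong) (auto simp: fiber_def sum_divide_distrib sum_distrib_left sum_distrib_right mult_ac)
      also have "\<dots> = (\<Sum>k<p. y (a, k) / of_nat p * (\<Sum>g\<in>fiber a. z g ^ j / z g ^ k))"
        unfolding sum_distrib_left by (rule sum.swap)
      also have "\<dots> = (\<Sum>k<p. if k = j then y (a, k) else 0)"
        by (rule sum.cong) (use True p_pos in \<open>auto simp: sum_fiber\<close>)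
      also have "\<dots> = y (a, j)"
        using True by simp
      finally show ?thesis using True by (simp add: i fourier_def)
    qed
  qed
qed (auto simp: fourier_def fiber_outside twisted_sum_algebra_def twisted_group_algebra_def)

text \<open>Both sides are the sum of \<open>F\<close> over \<open>S\<close>, grouped on the left by
  the product of the pair and on the right by the pair of images in \<open>A\<close>. The factor
  \<open>\<omega> ^ j\<close> of the summand \<open>j\<close> arises from expanding
  \<open>z (g \<otimes> h) ^ j\<close>.\<close>

lemma fourier_mult:
  "fourier (x \<otimes>\<^bsub>twisted_group_algebra G (inflate G \<pi> \<eta>)\<^esub> y)
    = fourier x \<otimes>\<^bsub>twisted_sum_algebra A \<omega> p \<eta>\<^esub> fourier y"
proof
  fix i :: "'c \<times> nat"
  obtain c :: 'c and j :: nat where i: "i = (c, j)" by (cases i)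
  show "fourier (x \<otimes>\<^bsub>twisted_group_algebra G (inflate G \<pi> \<eta>)\<^esub> y) i
    = (fourier x \<otimes>\<^bsub>twisted_sum_algebra A \<omega> p \<eta>\<^esub> fourier y) i"
  proof (cases "j < p")
    case False
    then show ?thesis by (simp add: i fourier_def twisted_sum_algebra_def)
  next
    case True
    define S where "S = {(g, h). g \<in> carrier G \<and> h \<in> carrier G \<and> \<pi> g \<otimes>\<^bsub>A\<^esub> \<pi> h = c}"
    define T where "T = {(a, b). a \<in> carrier A \<and> b \<in> carrier A \<and> a \<otimes>\<^bsub>A\<^esub> b = c}"
    define F where "F = (\<lambda>(g, h). x g * z g ^ j * (y h * z h ^ j)
      * (\<eta> (\<pi> g) (\<pi> h) * \<omega> (\<pi> g) (\<pi> h) ^ j))"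
    have finS: "finite S"
      by (rule finite_subset[of _ "carrier G \<times> carrier G"]) (auto simp: S_def fin_G)
    have finT: "finite T"
      by (rule finite_subset[of _ "carrier A \<times> carrier A"]) (auto simp: T_def finite_A)
    have "fourier (x \<otimes>\<^bsub>twisted_group_algebra G (inflate G \<pi> \<eta>)\<^esub> y) i
        = (\<Sum>k\<in>fiber c. (\<Sum>(g, h)\<in>{(g, h). g \<in> carrier G \<and> h \<in> carrier G \<and> g \<otimes> h = k}.
            x g * y h * inflate G \<pi> \<eta> g h) * z k ^ j)"
      using True by (simp add: i fourier_def twisted_group_algebra_def)
    also have "\<dots> = (\<Sum>k\<in>fiber c. \<Sum>s\<in>{s \<in> S. fst s \<otimes> snd s = k}. F s)"
    proof (rule sum.cong[OF refl])
      fix k assume k: "k \<in> fiber c"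
      have mem: "(g, h) \<in> S" if "g \<in> carrier G" "h \<in> carrier G" "g \<otimes> h = k" for g h
        using k that pi.hom_mult[of g h] unfolding S_def fiber_def by simp
      have mem': "g \<in> carrier G \<and> h \<in> carrier G" if "(g, h) \<in> S" for g h
        using that by (simp add: S_def)
      have set_eq: "{s \<in> S. fst s \<otimes> snd s = k}
          = {(g, h). g \<in> carrier G \<and> h \<in> carrier G \<and> g \<otimes> h = k}"
      proof (rule Set.set_eqI)
        fix s :: "'a \<times> 'a"
        obtain g h where s: "s = (g, h)" by (cases s)
        show "s \<in> {s \<in> S. fst s \<otimes> snd s = k}
            \<longleftrightarrow> s \<in> {(g, h). g \<in> carrier G \<and> h \<in> carrier G \<and> g \<otimes> h = k}"
          unfolding s using mem[of g h] mem'[of g h] by auto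
      qed
      show "(\<Sum>(g, h)\<in>{(g, h). g \<in> carrier G \<and> h \<in> carrier G \<and> g \<otimes> h = k}.
            x g * y h * inflate G \<pi> \<eta> g h) * z k ^ j = (\<Sum>s\<in>{s \<in> S. fst s \<otimes> snd s = k}. F s)"
        unfolding set_eq sum_distrib_right
        by (rule sum.cong) (auto simp: F_def inflate_def z_mult power_mult_distrib)
    qed
    also have "\<dots> = sum F S"
      by (rule sum.group[OF finS finite_fiber]) (auto simp: S_def fiber_def)
    also have "\<dots> = (\<Sum>t\<in>T. \<Sum>s\<in>{s \<in> S. (\<pi> (fst s), \<pi> (snd s)) = t}. F s)"
      by (rule sum.group[OF finS finT, symmetric]) (auto simp: S_def T_def)
    also have "\<dots> = (\<Sum>(a, b)\<in>T. fourier x (a, j) * fourier y (b, j) * (\<eta> a b * \<omega> a b ^ j))"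
    proof (rule sum.cong[OF refl])
      fix t assume t: "t \<in> T"
      obtain a b where ab: "t = (a, b)" by (cases t)
      have "{s \<in> S. (\<pi> (fst s), \<pi> (snd s)) = t} = fiber a \<times> fiber b"
      proof (rule Set.set_eqI)
        fix s :: "'a \<times> 'a"
        obtain g h where s: "s = (g, h)" by (cases s)
        show "s \<in> {s \<in> S. (\<pi> (fst s), \<pi> (snd s)) = t} \<longleftrightarrow> s \<in> fiber a \<times> fiber b"
          using t by (simp add: s ab S_def T_def fiber_def) blast
      qed
      moreover have "sum F (fiber a \<times> fiber b)
          = (\<Sum>(g, h)\<in>fiber a \<times> fiber b. x g * z g ^ j * (y h * z h ^ j) * (\<eta> a b * \<omega> a b ^ j))"
        by (rule sum.cong) (auto simp: F_def fiber_def)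
      moreover have prod: "fourier x (a, j) * fourier y (b, j)
          = (\<Sum>(g, h)\<in>fiber a \<times> fiber b. x g * z g ^ j * (y h * z h ^ j))"
        using True by (simp add: fourier_def sum_product sum.cartesian_product)
      ultimately show "(\<Sum>s\<in>{s \<in> S. (\<pi> (fst s), \<pi> (snd s)) = t}. F s) =
          (case t of (a, b) \<Rightarrow> fourier x (a, j) * fourier y (b, j) * (\<eta> a b * \<omega> a b ^ j))"
        by (simp add: ab prod sum_distrib_right split_def)
    qed
    finally show ?thesis by (simp add: i twisted_sum_algebra_def T_def)
  qed
qed

lemma twisted_group_algebra_decomposition:
  "complex_algebra_iso (twisted_group_algebra G (inflate G \<pi> \<eta>)) (twisted_sum_algebra A \<omega> p \<eta>)"
proof -
  let ?S = "twisted_group_algebra G (inflate G \<pi> \<eta>)" and ?T = "twisted_sum_algebra A \<omega> p \<eta>"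
  have bij: "bij_betw fourier (carrier ?S) (carrier ?T)" by (rule fourier_bij)
  have "fourier \<in> ring_hom ?S ?T"
  proof (rule ring_hom_memI)
    show "fourier x \<in> carrier ?T" if "x \<in> carrier ?S" for x
      using bij that by (auto simp: bij_betw_def)
    show "fourier (x \<oplus>\<^bsub>?S\<^esub> y) = fourier x \<oplus>\<^bsub>?T\<^esub> fourier y" for x y
      by (auto simp: fourier_def twisted_group_algebra_def twisted_sum_algebra_def fun_eq_iff
          sum.distrib distrib_right)
    show "fourier \<one>\<^bsub>?S\<^esub> = \<one>\<^bsub>?T\<^esub>"
    proof
      fix i :: "'c \<times> nat"
      obtain a :: 'c and j :: nat where i: "i = (a, j)" by (cases i)
      have "(\<Sum>g\<in>fiber a. (if g = \<one> then 1 / inflate G \<pi> \<eta> \<one> \<one> else 0) * z g ^ j)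
          = (\<Sum>g\<in>fiber a. if g = \<one> then 1 / \<eta> \<one>\<^bsub>A\<^esub> \<one>\<^bsub>A\<^esub> else 0)"
        by (rule sum.cong) (auto simp: z_one inflate_def)
      also have "\<dots> = (if a = \<one>\<^bsub>A\<^esub> then 1 / \<eta> \<one>\<^bsub>A\<^esub> \<one>\<^bsub>A\<^esub> else 0)"
        using finite_fiber by (auto simp: fiber_def)
      finally have "fourier \<one>\<^bsub>?S\<^esub> i = (if j < p then if a = \<one>\<^bsub>A\<^esub> then 1 / \<eta> \<one>\<^bsub>A\<^esub> \<one>\<^bsub>A\<^esub> else 0 else 0)"
        by (simp only: i fourier_def twisted_group_algebra_def monoid.simps prod.case)
      then show "fourier \<one>\<^bsub>?S\<^esub> i = \<one>\<^bsub>?T\<^esub> i"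
        by (simp add: i twisted_sum_algebra_def)
    qed
  qed (rule fourier_mult)
  moreover have "fourier (c \<odot>\<^bsub>?S\<^esub> x) = c \<odot>\<^bsub>?T\<^esub> fourier x" for c x
    by (auto simp: fourier_def twisted_group_algebra_def twisted_sum_algebra_def fun_eq_iff
        sum_distrib_left mult_ac)
  ultimately show ?thesis
    using bij unfolding complex_algebra_iso_def ring_iso_def by blast
qed

end

text \<open>Both groups \<open>H2\<close> are quotients of \<open>Z2 A\<close> by the same kernel,
  and the induced \<open>\<psi>\<close> sends the class of the inflation of \<open>\<eta>\<close> to
  \<open>G\<close> to that of its inflation to \<open>H\<close>. Both twisted algebras are
  isomorphic to \<open>twisted_sum_algebra A \<omega> p \<eta>\<close>.\<close>

theorem sim_C_heisenberg_covers:
  assumes "heisenberg_cover A \<omega> p G \<pi> z" "heisenberg_cover A \<omega> p H \<rho> y"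
  shows "sim_C G H"
proof -
  interpret G: heisenberg_cover A \<omega> p G \<pi> z by fact
  interpret H: heisenberg_cover A \<omega> p H \<rho> y by fact
  obtain \<psi> where \<psi>: "\<psi> \<in> iso (H2 G) (H2 H)"
    "\<And>\<eta>. \<eta> \<in> cocycles2 A \<Longrightarrow> \<psi> (G.class_map \<eta>) = H.class_map \<eta>"
    using hom_iso_same_kernel[OF G.group_hom_class_map H.group_hom_class_map
        G.class_map_surj H.class_map_surj] G.class_map_kernel H.class_map_kernel by auto
  have "complex_algebra_iso (twisted_group_algebra G \<alpha>) (twisted_group_algebra H \<beta>)"
    if X: "X \<in> carrier (H2 G)" "\<alpha> \<in> X" "\<beta> \<in> \<psi> X" for X \<alpha> \<beta>
  proof -
    obtain \<eta> where \<eta>: "\<eta> \<in> cocycles2 A" "X = G.class_map \<eta>"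
      using X(1) G.class_map_surj by auto
    let ?\<gamma> = "inflate G \<pi> \<eta>" and ?\<delta> = "inflate H \<rho> \<eta>"
    have \<gamma>: "?\<gamma> \<in> G.class_map \<eta>"
      unfolding G.class_map_def using G.inflate_cocycle[OF \<eta>(1)] G.G.coboundaries2_subgroup
      by (intro group.rcos_self[OF comm_group.axioms(2)[OF comm_group_Z2]]) auto
    have \<delta>: "?\<delta> \<in> H.class_map \<eta>"
      unfolding H.class_map_def using H.inflate_cocycle[OF \<eta>(1)] H.G.coboundaries2_subgroup
      by (intro group.rcos_self[OF comm_group.axioms(2)[OF comm_group_Z2]]) auto
    have "\<alpha> \<in> G.class_map \<eta>" "\<beta> \<in> H.class_map \<eta>"
      using X(2,3) \<eta>(2) \<psi>(2)[OF \<eta>(1)] by auto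
    then have "complex_algebra_iso (twisted_group_algebra G \<alpha>) (twisted_group_algebra G ?\<gamma>)"
      "complex_algebra_iso (twisted_group_algebra H ?\<delta>) (twisted_group_algebra H \<beta>)"
      using G.G.twisted_group_algebra_same_class[OF G.inflate_cocycle[OF \<eta>(1)] _ \<gamma>[unfolded G.class_map_def]]
        H.G.twisted_group_algebra_same_class[OF H.inflate_cocycle[OF \<eta>(1)] \<delta>[unfolded H.class_map_def]]
      unfolding G.class_map_def H.class_map_def by auto
    moreover have "complex_algebra_iso (twisted_group_algebra G ?\<gamma>) (twisted_group_algebra H ?\<delta>)"
      by (rule complex_algebra_iso_trans[OF G.twisted_group_algebra_decomposition
          H.G.twisted_group_algebra_sym[OF H.twisted_group_algebra_decomposition]])
    ultimately show ?thesis by (meson complex_algebra_iso_trans)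
  qed
  then show ?thesis using \<psi>(1) unfolding sim_C_def by blast
qed

section \<open>The groups of the family \<open>\<Phi>\<^sub>5\<close>\<close>

type_synonym int4 = "int \<times> int \<times> int \<times> int"

text \<open>The coordinates are the exponents of \<open>A1\<close>, \<open>A2\<close>,
  \<open>A3\<close>, \<open>A4\<close> modulo \<open>B\<close>.\<close>

definition phi5_base :: "nat \<Rightarrow> int4 monoid" where
  "phi5_base p = integer_mod_group (p ^ 2) \<times>\<times> integer_mod_group p
    \<times>\<times> integer_mod_group p \<times>\<times> integer_mod_group p"

definition root_char :: "nat \<Rightarrow> int \<Rightarrow> complex" where
  "root_char p k = cis (2 * pi * of_int k / of_nat p)"

text \<open>This cocycle is not symmetric: the quotient of its values at \<open>(a, b)\<close> and
  \<open>(b, a)\<close> is the root of unity with exponent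
  \<open>a1 * b2 - a2 * b1 + a3 * b4 - a4 * b3\<close>, the symplectic form given by commutators in
  the extension.\<close>

fun phi5_form :: "nat \<Rightarrow> int4 \<Rightarrow> int4 \<Rightarrow> complex" where
  "phi5_form p (a1, a2, a3, a4) (b1, b2, b3, b4) =
    (if (a1, a2, a3, a4) \<in> carrier (phi5_base p) \<and> (b1, b2, b3, b4) \<in> carrier (phi5_base p)
     then root_char p (a1 * b2) * root_char p (a3 * b4) else 1)"

section \<open>Powers of a primitive root of unity\<close>

lemma root_char_add: "root_char p (k + l) = root_char p k * root_char p l"
  by (simp add: root_char_def cis_mult add_divide_distrib distrib_left)

lemma root_char_nonzero: "root_char p k \<noteq> 0"
  by (simp add: root_char_def)

lemma root_char_0 [simp]: "root_char p 0 = 1"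
  by (simp add: root_char_def)

text \<open>The four presentations differ only in which of the powers equals \<open>B\<close>; the
  flags put them into one family to be treated at once.\<close>

definition phi5_relations ::
  "nat \<Rightarrow> bool \<Rightarrow> bool \<Rightarrow> bool \<Rightarrow> (phi5_gen word \<times> phi5_gen word) set" where
  "phi5_relations p e1 e2 e3 = phi5_common p \<union>
    {(word_pow (gen A1) (p ^ 2), if e1 then gen B else []),
     (word_pow (gen A2) p, if e2 then gen B else []),
     (word_pow (gen A3) p, if e3 then gen B else []),
     (word_pow (gen A4) p, [])}"

context
  fixes p :: nat
  assumes p: "prime p"
begin

lemma p_gt_1: "p > 1" using p by (rule prime_gt_1_nat)

lemma root_char_dvd:
  assumes "int p dvd k"
  shows "root_char p k = 1"
proof -
  obtain m where "k = int p * m" using assms by (auto elim: dvdE)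
  then have "2 * pi * real_of_int k / real p = 2 * pi * of_int m"
    using p_gt_1 by simp
  then show ?thesis by (simp add: root_char_def)
qed

lemma root_char_cong:
  assumes "int p dvd k - l"
  shows "root_char p k = root_char p l"
  using root_char_add[of p "k - l" l] root_char_dvd[OF assms] by simp

text \<open>Used with \<open>n = p\<close> and with \<open>n = p ^ 2\<close>, since the first
  coordinate of the base is reduced modulo \<open>p ^ 2\<close>.\<close>

lemma root_char_mult_mod:
  assumes "p dvd n"
  shows "root_char p ((k mod int n) * l) = root_char p (k * l)"
    and "root_char p (l * (k mod int n)) = root_char p (l * k)"
proof -
  have "int p dvd k mod int n - k"
    using assms by (metis dvd_trans int_dvd_int_iff mod_eq_dvd_iff mod_mod_trivial)
  then have "int p dvd (k mod int n - k) * l" by (rule dvd_mult2)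
  then show "root_char p ((k mod int n) * l) = root_char p (k * l)"
    and "root_char p (l * (k mod int n)) = root_char p (l * k)"
    by (auto intro!: root_char_cong simp: algebra_simps)
qed

lemma root_char_root:
  assumes "w ^ p = 1"
  obtains k where "0 \<le> k" "k < int p" "w = root_char p k"
proof -
  obtain k where "k < p" "w = cis (2 * pi * real k / real p)"
    using bij_betw_roots_unity[of p] p_gt_1 assms by (auto simp: bij_betw_def image_iff)
  then show thesis by (intro that[of "int k"]) (auto simp: root_char_def)
qed

section \<open>The abelian base and its bilinear cocycle\<close>

lemma carrier_phi5_base:
  "(a1, a2, a3, a4) \<in> carrier (phi5_base p) \<longleftrightarrow>
    a1 \<in> {0..<int p ^ 2} \<and> a2 \<in> {0..<int p} \<and> a3 \<in> {0..<int p} \<and> a4 \<in> {0..<int p}"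
  using p_gt_1 by (simp add: phi5_base_def carrier_integer_mod_group)

lemma mult_phi5_base:
  "(a1, a2, a3, a4) \<otimes>\<^bsub>phi5_base p\<^esub> (b1, b2, b3, b4) =
    ((a1 + b1) mod int (p ^ 2), (a2 + b2) mod int p, (a3 + b3) mod int p, (a4 + b4) mod int p)"
  by (simp add: phi5_base_def)

lemma one_phi5_base: "\<one>\<^bsub>phi5_base p\<^esub> = (0, 0, 0, 0)"
  by (simp add: phi5_base_def)

lemma group_phi5_base: "group (phi5_base p)"
  unfolding phi5_base_def by (intro DirProd_group group_integer_mod_group)

lemma comm_group_phi5_base: "comm_group (phi5_base p)"
  by (rule group.group_comm_groupI[OF group_phi5_base])
    (auto simp: mult_phi5_base add.commute)

lemma card_phi5_base: "card (carrier (phi5_base p)) = p ^ 5"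
  using p_gt_1
  by (simp add: phi5_base_def carrier_integer_mod_group card_cartesian_product power_numeral_reduce
      nat_mult_distrib)

lemma phi5_form_cocycle: "phi5_form p \<in> cocycles2 (phi5_base p)"
proof -
  interpret A: group "phi5_base p" by (rule group_phi5_base)
  have "phi5_form p a b * phi5_form p (a \<otimes>\<^bsub>phi5_base p\<^esub> b) c
      = phi5_form p b c * phi5_form p a (b \<otimes>\<^bsub>phi5_base p\<^esub> c)"
    if abc: "a \<in> carrier (phi5_base p)" "b \<in> carrier (phi5_base p)" "c \<in> carrier (phi5_base p)" for a b c
  proof -
    obtain a1 a2 a3 a4 where a: "a = (a1, a2, a3, a4)" by (cases a) auto
    obtain b1 b2 b3 b4 where b: "b = (b1, b2, b3, b4)" by (cases b) auto
    obtain c1 c2 c3 c4 where c: "c = (c1, c2, c3, c4)" by (cases c) auto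
    \<comment> \<open>Membership of the products selects the nontrivial branch of
      \<open>phi5_form\<close>; what remains is bilinearity of the exponent modulo
      \<open>p\<close>.\<close>
    have "a \<otimes>\<^bsub>phi5_base p\<^esub> b \<in> carrier (phi5_base p)" "b \<otimes>\<^bsub>phi5_base p\<^esub> c \<in> carrier (phi5_base p)"
      using abc by auto
    then show ?thesis
      using abc unfolding a b c mult_phi5_base phi5_form.simps
      by (simp only: root_char_mult_mod[OF dvd_refl] root_char_mult_mod[of "p ^ 2"] dvd_power simp_thms
          if_True zero_less_numeral distrib_left distrib_right root_char_add mult_ac)
  qed
  moreover have "phi5_form p a b \<noteq> 0" for a b
    by (cases a; cases b) (auto simp: root_char_nonzero)
  moreover have "phi5_form p a b = 1"
    if "\<not> (a \<in> carrier (phi5_base p) \<and> b \<in> carrier (phi5_base p))" for a b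
    using that by (cases a; cases b) (auto simp del: not_le)
  ultimately show ?thesis unfolding cocycles2_def by blast
qed

lemma heisenberg_base_phi5: "heisenberg_base (phi5_base p) (phi5_form p) p"
proof (intro heisenberg_base.intro heisenberg_base_axioms.intro)
  show "p > 0" using p_gt_1 by simp
  show "phi5_form p \<one>\<^bsub>phi5_base p\<^esub> \<one>\<^bsub>phi5_base p\<^esub> = 1"
    by (simp add: one_phi5_base)
  fix a assume a: "a \<in> carrier (phi5_base p)"
  obtain a1 a2 a3 a4 where a_eq: "a = (a1, a2, a3, a4)" by (cases a) auto
  note bounds = a[unfolded a_eq carrier_phi5_base]
  \<comment> \<open>The splitting reflects the central product: elements in the last two coordinates
    commute with \<open>?b\<close>, those in the first two with \<open>?c\<close>. In either pair of
    coordinates \<open>k\<close> times the first basis vector and the second basis vector have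
    commutator \<open>root_char p k\<close>.\<close>
  let ?b = "(a1, a2, 0, 0) :: int4" and ?c = "(0, 0, a3, a4) :: int4"
  have p2: "int p \<le> int p ^ 2" "1 < int p" using p_gt_1 by (simp_all add: power2_eq_square)
  show "\<exists>b\<in>carrier (phi5_base p). \<exists>c\<in>carrier (phi5_base p). a = b \<otimes>\<^bsub>phi5_base p\<^esub> c \<and>
      (\<forall>d\<in>{b, c}. \<forall>w. w ^ p = 1 \<longrightarrow> (\<exists>u\<in>carrier (phi5_base p). \<exists>v\<in>carrier (phi5_base p).
        phi5_form p d u = phi5_form p u d \<and> phi5_form p d v = phi5_form p v d \<and>
        phi5_form p u v = w * phi5_form p v u))"
  proof (rule bexI[of _ ?b], rule bexI[of _ ?c], intro conjI ballI allI impI)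
    show "a = ?b \<otimes>\<^bsub>phi5_base p\<^esub> ?c"
      using bounds by (simp add: a_eq mult_phi5_base)
    show bc: "?b \<in> carrier (phi5_base p)" "?c \<in> carrier (phi5_base p)"
      using bounds p2 by (auto simp: carrier_phi5_base)
    fix d w assume d: "d \<in> {?b, ?c}" and w: "w ^ p = (1::complex)"
    obtain k where k: "0 \<le> k" "k < int p" "w = root_char p k" by (rule root_char_root[OF w])
    show "\<exists>u\<in>carrier (phi5_base p). \<exists>v\<in>carrier (phi5_base p).
        phi5_form p d u = phi5_form p u d \<and> phi5_form p d v = phi5_form p v d \<and>
        phi5_form p u v = w * phi5_form p v u"
    proof (cases "d = ?b")
      case True
      have "(0, 0, k, 0) \<in> carrier (phi5_base p)" "(0, 0, 0, 1) \<in> carrier (phi5_base p)"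
        using k(1,2) p2 by (simp_all add: carrier_phi5_base)
      then show ?thesis
        using bc by (intro bexI[of _ "(0, 0, k, 0)"] bexI[of _ "(0, 0, 0, 1)"]) (simp_all add: True k(3))
    next
      case False
      then have dc: "d = ?c" using d by simp
      have "(k, 0, 0, 0) \<in> carrier (phi5_base p)" "(0, 1, 0, 0) \<in> carrier (phi5_base p)"
        using k(1) order_less_le_trans[OF k(2) p2(1)] p2(2) by (simp_all add: carrier_phi5_base)
      then show ?thesis
        using bc by (intro bexI[of _ "(k, 0, 0, 0)"] bexI[of _ "(0, 1, 0, 0)"]) (simp_all add: dc k(3))
    qed
  qed
qed (rule comm_group_phi5_base phi5_form_cocycle)+

text \<open>The generators are mapped to the extension of the base so that all relations hold. The
  composite is onto the base, and \<open>p ^ 6 = p ^ 5 * p\<close> leaves a kernel of exactly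
  \<open>p\<close> elements, on which \<open>z\<close> takes every \<open>p\<close>-th root of unity
  and is therefore bijective.\<close>

lemma heisenberg_cover_phi5:
  fixes G :: "('a, 'm) monoid_scheme"
  assumes G: "group G" "order G = p ^ 6" and iso: "G \<cong> presented_group (phi5_relations p e1 e2 e3)"
  shows "\<exists>\<pi> z. heisenberg_cover (phi5_base p) (phi5_form p) p G \<pi> z"
proof -
  let ?R = "phi5_relations p e1 e2 e3"
  let ?A = "phi5_base p" and ?E = "cocycle_extension (phi5_base p) (phi5_form p)"
  interpret base: heisenberg_base ?A "phi5_form p" p by (rule heisenberg_base_phi5)
  interpret E: group ?E by (rule base.group_cocycle_extension[OF phi5_form_cocycle])
  interpret G: group G by fact
  have p2: "int p \<le> int p ^ 2" "1 < int p" "1 < int p ^ 2" "p > 0" "p ^ 2 > 0"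
    using p_gt_1 by (simp_all add: power2_eq_square less_1_mult)
  \<comment> \<open>The scalar of the right-hand side of a power relation, \<open>B\<close> being
    sent to \<open>root_char p 1\<close>. Complex roots of it serve as the scalars of
    \<open>A1\<close>, \<open>A2\<close> and \<open>A3\<close>.\<close>
  define v where "v e = (if e then root_char p 1 else 1)" for e
  have v_nz: "v e \<noteq> 0" for e by (simp add: v_def root_char_nonzero)
  obtain l1 where l1: "l1 ^ (p ^ 2) = v e1" using complex_root_exists[OF p2(5) v_nz] by blast
  obtain l2 where l2: "l2 ^ p = v e2" using complex_root_exists[OF p2(4) v_nz] by blast
  obtain l3 where l3: "l3 ^ p = v e3" using complex_root_exists[OF p2(4) v_nz] by blast
  have l_nz: "l1 \<noteq> 0" "l2 \<noteq> 0" "l3 \<noteq> 0"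
    using l1 l2 l3 v_nz p2 by (auto simp: power_0_left)
  define \<rho> :: "phi5_gen \<Rightarrow> int4 \<times> complex" where "\<rho> x = (case x of A1 \<Rightarrow> ((1, 0, 0, 0), l1) | A2 \<Rightarrow> ((0, 1, 0, 0), l2)
    | A3 \<Rightarrow> ((0, 0, 1, 0), l3) | A4 \<Rightarrow> ((0, 0, 0, 1), 1) | B \<Rightarrow> ((0, 0, 0, 0), root_char p 1))"
    for x
  have \<rho>: "\<rho> x \<in> carrier ?E" for x
    using p2 l_nz by (cases x) (simp_all add: \<rho>_def carrier_phi5_base root_char_nonzero)
  note eval = E.word_eval_append[of \<rho>, OF \<rho>] E.word_eval_gen[of \<rho>, OF \<rho>]
    E.word_eval_word_pow[of \<rho>, OF \<rho>] E.word_eval_Nil[of \<rho>, OF \<rho>]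
  have one: "\<one>\<^bsub>?E\<^esub> = ((0, 0, 0, 0), 1)"
    by (simp add: one_phi5_base)
  \<comment> \<open>The form is 1 on any two multiples of one basis vector, so scalars of powers of
    a single generator multiply without correction.\<close>
  have pow1: "\<rho> A1 [^]\<^bsub>?E\<^esub> n = ((int n mod int (p ^ 2), 0, 0, 0), l1 ^ n)" for n :: nat
    by (induction n) (simp_all add: one \<rho>_def mult_phi5_base carrier_phi5_base mod_simps add.commute
        del: one_cocycle_extension)
  have pow2: "\<rho> A2 [^]\<^bsub>?E\<^esub> n = ((0, int n mod int p, 0, 0), l2 ^ n)" for n :: nat
    by (induction n) (simp_all add: one \<rho>_def mult_phi5_base carrier_phi5_base mod_simps add.commute
        del: one_cocycle_extension)
  have pow3: "\<rho> A3 [^]\<^bsub>?E\<^esub> n = ((0, 0, int n mod int p, 0), l3 ^ n)" for n :: nat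
    by (induction n) (simp_all add: one \<rho>_def mult_phi5_base carrier_phi5_base mod_simps add.commute
        del: one_cocycle_extension)
  have pow4: "\<rho> A4 [^]\<^bsub>?E\<^esub> n = ((0, 0, 0, int n mod int p), 1)" for n :: nat
    by (induction n) (simp_all add: one \<rho>_def mult_phi5_base carrier_phi5_base mod_simps add.commute
        del: one_cocycle_extension)
  have powB: "\<rho> B [^]\<^bsub>?E\<^esub> n = ((0, 0, 0, 0), root_char p (int n))" for n :: nat
    by (induction n) (simp_all add: one \<rho>_def mult_phi5_base carrier_phi5_base root_char_add[symmetric]
        add.commute del: one_cocycle_extension)
  have eval_r: "word_eval ?E \<rho> (if e then gen B else []) = ((0, 0, 0, 0), v e)" for e
    by (simp add: v_def eval one \<rho>_def del: one_cocycle_extension)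
  have comm: "word_eval ?E \<rho> (word_comm (gen x) (gen y)) = s"
    if "\<rho> x \<otimes>\<^bsub>?E\<^esub> \<rho> y = \<rho> y \<otimes>\<^bsub>?E\<^esub> \<rho> x \<otimes>\<^bsub>?E\<^esub> s" "s \<in> carrier ?E" for x y s
    by (rule E.word_eval_word_comm[of \<rho>, OF \<rho>]) (use that in \<open>simp_all add: eval\<close>)
  have relations: "word_eval ?E \<rho> u = word_eval ?E \<rho> w" if uw: "(u, w) \<in> ?R" for u w
  proof -
    have "word_eval ?E \<rho> (word_comm (gen A1) (gen A2)) = word_eval ?E \<rho> (gen B)"
      "word_eval ?E \<rho> (word_comm (gen A3) (gen A4)) = word_eval ?E \<rho> (gen B)"
      unfolding eval using p2 by (intro comm; simp add: \<rho>_def mult_phi5_base carrier_phi5_base root_char_nonzero)+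
    moreover have "word_eval ?E \<rho> (word_comm (gen x) (gen y)) = word_eval ?E \<rho> []"
      if "{x, y} \<noteq> {A1, A2}" "{x, y} \<noteq> {A3, A4}" for x y
      unfolding eval
    proof (rule comm)
      show "\<rho> x \<otimes>\<^bsub>?E\<^esub> \<rho> y = \<rho> y \<otimes>\<^bsub>?E\<^esub> \<rho> x \<otimes>\<^bsub>?E\<^esub> \<one>\<^bsub>?E\<^esub>"
        unfolding one using p2 that
        by (cases x; cases y; simp add: \<rho>_def mult_phi5_base carrier_phi5_base insert_commute)
    qed (rule E.one_closed)
    moreover have "word_eval ?E \<rho> (word_pow (gen B) p) = word_eval ?E \<rho> []"
      by (simp add: eval powB one root_char_dvd del: one_cocycle_extension)
    moreover have "word_eval ?E \<rho> (word_pow (gen A1) (p ^ 2)) = word_eval ?E \<rho> (if e1 then gen B else [])"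
      "word_eval ?E \<rho> (word_pow (gen A2) p) = word_eval ?E \<rho> (if e2 then gen B else [])"
      "word_eval ?E \<rho> (word_pow (gen A3) p) = word_eval ?E \<rho> (if e3 then gen B else [])"
      "word_eval ?E \<rho> (word_pow (gen A4) p) = word_eval ?E \<rho> []"
      by (simp_all add: eval eval_r pow1 pow2 pow3 pow4 l1 l2 l3 one del: one_cocycle_extension)
    ultimately show ?thesis using uw unfolding phi5_relations_def phi5_common_def by blast
  qed
  obtain \<phi> where \<phi>: "\<phi> \<in> hom (presented_group ?R) ?E"
    "\<And>w. word_eval ?E \<rho> w \<in> \<phi> ` carrier (presented_group ?R)"
    by (rule E.presented_group_hom[of \<rho> ?R, OF \<rho> relations], assumption) (rule that)
  obtain \<theta> where \<theta>: "\<theta> \<in> hom G (presented_group ?R)" "\<theta> ` carrier G = carrier (presented_group ?R)"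
    using iso by (auto simp: is_iso_def iso_def bij_betw_def)
  define \<Phi> where "\<Phi> = \<phi> \<circ> \<theta>"
  have \<Phi>: "\<Phi> \<in> hom G ?E"
    unfolding \<Phi>_def by (rule Group.hom_compose[OF \<theta>(1) \<phi>(1)])
  have range: "\<exists>g\<in>carrier G. \<Phi> g = word_eval ?E \<rho> w" for w
    using \<phi>(2)[of w] unfolding \<theta>(2)[symmetric] by (auto simp: \<Phi>_def)
  define \<pi> where "\<pi> g = fst (\<Phi> g)" for g
  define z where "z g = snd (\<Phi> g)" for g
  have \<Phi>_eq: "\<Phi> g = (\<pi> g, z g)" for g by (simp add: \<pi>_def z_def)
  have closed: "\<pi> g \<in> carrier ?A \<and> z g \<noteq> 0" if "g \<in> carrier G" for g
    using hom_in_carrier[OF \<Phi> that] by (simp add: \<Phi>_eq)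
  have mult: "\<pi> (g \<otimes>\<^bsub>G\<^esub> h) = \<pi> g \<otimes>\<^bsub>?A\<^esub> \<pi> h \<and> z (g \<otimes>\<^bsub>G\<^esub> h) = z g * z h * phi5_form p (\<pi> g) (\<pi> h)"
    if "g \<in> carrier G" "h \<in> carrier G" for g h
    using hom_mult[OF \<Phi> that] by (simp add: \<Phi>_eq)
  have \<pi>: "\<pi> \<in> hom G ?A" by (rule homI) (auto simp: closed mult)
  interpret pi: group_hom G ?A \<pi>
    by (simp add: group_hom_def group_hom_axioms_def G.is_group base.is_group \<pi>)
  have surj: "\<pi> ` carrier G = carrier ?A"
  proof
    show "carrier ?A \<subseteq> \<pi> ` carrier G"
    proof
      fix a assume a: "a \<in> carrier ?A"
      obtain a1 a2 a3 a4 where a_eq: "a = (a1, a2, a3, a4)" by (cases a) auto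
      note bounds = a[unfolded a_eq carrier_phi5_base]
      obtain g where g: "g \<in> carrier G" "\<Phi> g = word_eval ?E \<rho> (word_pow (gen A1) (nat a1)
          @ word_pow (gen A2) (nat a2) @ word_pow (gen A3) (nat a3) @ word_pow (gen A4) (nat a4))"
        using range by blast
      have "\<pi> g = a"
        using bounds unfolding \<pi>_def g(2) eval pow1 pow2 pow3 pow4
        by (simp add: mult_phi5_base a_eq)
      then show "a \<in> \<pi> ` carrier G" using g(1) by blast
    qed
  qed (auto simp: closed)
  let ?N = "kernel G ?A \<pi>" and ?U = "{w::complex. w ^ p = 1}"
  have fin: "finite (carrier G)"
    using G(2) p2 by (intro card_ge_0_finite) (simp add: order_def)
  have card_N: "card ?N = p"
  proof -
    have "card (rcosets\<^bsub>G\<^esub> ?N) * card ?N = p ^ 6"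
      using G.lagrange[OF pi.subgroup_kernel] G(2) by simp
    moreover have "card (rcosets\<^bsub>G\<^esub> ?N) = p ^ 5"
      using pi.FactGroup_iso_set[OF surj] bij_betw_same_card card_phi5_base
      by (fastforce simp: iso_def FactGroup_def)
    ultimately have "p ^ 5 * card ?N = p ^ 5 * p"
      using power_Suc2[of p 5] by simp
    then show ?thesis using p2(4) by simp
  qed
  have finN: "finite ?N" using fin by (simp add: kernel_def)
  have cardU: "card ?U = p" using card_roots_unity_eq[of p] p2 by simp
  \<comment> \<open>Preimages of the powers of \<open>B\<close> lie in the kernel and realise every
    root of unity as a \<open>z\<close>-value.\<close>
  have sub: "?U \<subseteq> z ` ?N"
  proof
    fix w assume "w \<in> ?U"
    then obtain k where k: "0 \<le> k" "w = root_char p k" using root_char_root by blast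
    obtain g where g: "g \<in> carrier G" "\<Phi> g = word_eval ?E \<rho> (word_pow (gen B) (nat k))"
      using range by blast
    then have "g \<in> ?N" "z g = w"
      using k by (simp_all add: \<pi>_def z_def eval powB kernel_def one_phi5_base)
    then show "w \<in> z ` ?N" by blast
  qed
  have "card (z ` ?N) \<le> p" using card_image_le[OF finN, of z] card_N by simp
  then have img: "?U = z ` ?N"
    using sub cardU finN by (intro card_seteq) auto
  then have "inj_on z ?N"
    using finN cardU card_N by (intro eq_card_imp_inj_on) auto
  then have "bij_betw z ?N ?U" using img by (simp add: bij_betw_def)
  then have "heisenberg_cover ?A (phi5_form p) p G \<pi> z"
    using fin \<pi> surj closed mult
    by (intro heisenberg_cover.intro heisenberg_cover_axioms.intro heisenberg_base_phi5 G(1)) auto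
  then show ?thesis by blast
qed

end

theorem theorem3p4:
  fixes p :: nat
    and G :: "('a, 'm) monoid_scheme"
    and H :: "('b, 'n) monoid_scheme"
  assumes "prime p" and "odd p"
    and "group G" and "order G = p ^ 6"
    and "group H" and "order H = p ^ 6"
    and "\<exists>P\<in>{Phi5_3111 p, Phi5_2211a p, Phi5_2211b p, Phi5_21111c p}. G \<cong> P"
    and "\<exists>Q\<in>{Phi5_3111 p, Phi5_2211a p, Phi5_2211b p, Phi5_21111c p}. H \<cong> Q"
  shows "sim_C G H"
proof -
  have "\<exists>e1 e2 e3. P = presented_group (phi5_relations p e1 e2 e3)"
    if "P \<in> {Phi5_3111 p, Phi5_2211a p, Phi5_2211b p, Phi5_21111c p}" for P
  proof -
    have "Phi5_3111 p = presented_group (phi5_relations p True False False)"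
      "Phi5_2211a p = presented_group (phi5_relations p False True False)"
      "Phi5_2211b p = presented_group (phi5_relations p False False True)"
      "Phi5_21111c p = presented_group (phi5_relations p False False False)"
      by (simp_all add: Phi5_3111_def Phi5_2211a_def Phi5_2211b_def Phi5_21111c_def
          phi5_relations_def insert_commute)
    then show ?thesis using that by blast
  qed
  then obtain e1 e2 e3 e1' e2' e3' where
    "G \<cong> presented_group (phi5_relations p e1 e2 e3)"
    "H \<cong> presented_group (phi5_relations p e1' e2' e3')"
    using assms(7,8) by metis
  then obtain \<pi> z \<pi>' z' where "heisenberg_cover (phi5_base p) (phi5_form p) p G \<pi> z"
    "heisenberg_cover (phi5_base p) (phi5_form p) p H \<pi>' z'"
    using heisenberg_cover_phi5[OF assms(1)] assms(3-6) by meson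
  then show ?thesis by (rule sim_C_heisenberg_covers)
qed

end
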